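(* No countable linear ordering has Scott sentence complexity $\Sigma^{\mathrm{in}}_3$; that is, there is no countable linear ordering which has a $\Sigma^{\mathrm{in}}_3$ Scott sentence but no Scott sentence that is $\Pi^{\mathrm{in}}_3$ or of lower complexity.
   Context: Infinitary formulas: $\Sigma^{\mathrm{in}}_0=\Pi^{\mathrm{in}}_0$ are the finitary quantifier-free formulas; for $\alpha\ge1$, a $\Sigma^{\mathrm{in}}_\alpha$ formula is a countable disjunction of formulas $\exists\bar x\,\varphi$ with $\varphi\in\Pi^{\mathrm{in}}_\beta$, $\beta<\alpha$, and $\Pi^{\mathrm{in}}_\alpha$ is dual. A $d\text{-}\Sigma^{\mathrm{in}}_\alpha$ formula is a conjunction of a $\Sigma^{\mathrm{in}}_\alpha$ and a $\Pi^{\mathrm{in}}_\alpha$ formula. A Scott sentence of a countable structure is an $L_{\omega_1\omega}$ sentence whose countable models are exactly its isomorphic copies. The Scott sentence complexity $SSC(\mathcal{A})$ is the least class among $\Pi^{\mathrm{in}}_\alpha,\Sigma^{\mathrm{in}}_\alpha,d\text{-}\Sigma^{\mathrm{in}}_\alpha$ ($\alpha\ge1$) in which $\mathcal{A}$ has a Scott sentence, classes ordered by inclusion up to equivalence ($\Pi_\alpha,\Sigma_\alpha\subseteq d\text{-}\Sigma_\alpha\subseteq \Sigma_{\alpha+1}\cap\Pi_{\alpha+1}$). *)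

theory Defs
  imports "HOL-Library.Countable_Set"
begin

unbundle cardinal_syntax

text \<open>
  Formulas of \<open>L\<^bsub>\<omega>\<^sub>1\<omega>\<^esub>\<close> over the language with one binary relation symbol, written \<open>Le\<close>; variables
  are natural numbers. Countable conjunctions and disjunctions are enumerated by \<open>nat\<close>; finite
  families are covered by repetition, the empty ones by \<open>\<forall>x. x = x\<close> and \<open>\<exists>x. x \<noteq> x\<close>. In a
  formula with finitely many free variables (in particular in a sentence) every subformula again
  has only finitely many free variables.
\<close>

datatype fm =
    Eq nat nat
  | Le nat nat
  | Neg fm
  | And fm fm
  | Or fm fm
  | Conj "nat \<Rightarrow> fm"
  | Disj "nat \<Rightarrow> fm"
  | Ex nat fm
  | All nat fm

primrec sat :: "'a set \<Rightarrow> 'a rel \<Rightarrow> fm \<Rightarrow> (nat \<Rightarrow> 'a) \<Rightarrow> bool" where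
  "sat A R (Eq m n) = (\<lambda>v. v m = v n)"
| "sat A R (Le m n) = (\<lambda>v. (v m, v n) \<in> R)"
| "sat A R (Neg \<phi>) = (\<lambda>v. \<not> sat A R \<phi> v)"
| "sat A R (And \<phi> \<psi>) = (\<lambda>v. sat A R \<phi> v \<and> sat A R \<psi> v)"
| "sat A R (Or \<phi> \<psi>) = (\<lambda>v. sat A R \<phi> v \<or> sat A R \<psi> v)"
| "sat A R (Conj \<Phi>) = (\<lambda>v. \<forall>i. sat A R (\<Phi> i) v)"
| "sat A R (Disj \<Phi>) = (\<lambda>v. \<exists>i. sat A R (\<Phi> i) v)"
| "sat A R (Ex n \<phi>) = (\<lambda>v. \<exists>x\<in>A. sat A R \<phi> (v(n := x)))"
| "sat A R (All n \<phi>) = (\<lambda>v. \<forall>x\<in>A. sat A R \<phi> (v(n := x)))"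

primrec fv :: "fm \<Rightarrow> nat set" where
  "fv (Eq m n) = {m, n}"
| "fv (Le m n) = {m, n}"
| "fv (Neg \<phi>) = fv \<phi>"
| "fv (And \<phi> \<psi>) = fv \<phi> \<union> fv \<psi>"
| "fv (Or \<phi> \<psi>) = fv \<phi> \<union> fv \<psi>"
| "fv (Conj \<Phi>) = (\<Union>i. fv (\<Phi> i))"
| "fv (Disj \<Phi>) = (\<Union>i. fv (\<Phi> i))"
| "fv (Ex n \<phi>) = fv \<phi> - {n}"
| "fv (All n \<phi>) = fv \<phi> - {n}"

definition exs :: "nat list \<Rightarrow> fm \<Rightarrow> fm" where
  "exs xs \<phi> = foldr Ex xs \<phi>"

definition alls :: "nat list \<Rightarrow> fm \<Rightarrow> fm" where
  "alls xs \<phi> = foldr All xs \<phi>"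

inductive qfree :: "fm \<Rightarrow> bool" where
  "qfree (Eq m n)"
| "qfree (Le m n)"
| "qfree \<phi> \<Longrightarrow> qfree (Neg \<phi>)"
| "qfree \<phi> \<Longrightarrow> qfree \<psi> \<Longrightarrow> qfree (And \<phi> \<psi>)"
| "qfree \<phi> \<Longrightarrow> qfree \<psi> \<Longrightarrow> qfree (Or \<phi> \<psi>)"

text \<open>
  Countable ordinals are represented by well-orders on sets of natural numbers and compared by
  \<open><o\<close>; the empty relation is the ordinal 0 and \<open>natLeq_on n\<close> is the finite ordinal \<open>n\<close>.
  (\<open>\<beta> <o \<alpha>\<close> entails that both sides are well-orders.)
\<close>

inductive Sigma_in :: "nat rel \<Rightarrow> fm \<Rightarrow> bool" and Pi_in :: "nat rel \<Rightarrow> fm \<Rightarrow> bool" where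
  Sigma_0: "qfree \<phi> \<Longrightarrow> Sigma_in {} \<phi>"
| Pi_0: "qfree \<phi> \<Longrightarrow> Pi_in {} \<phi>"
| Sigma_step: "(\<And>i. \<exists>\<beta>. \<beta> <o \<alpha> \<and> Pi_in \<beta> (\<phi> i)) \<Longrightarrow> Sigma_in \<alpha> (Disj (\<lambda>i. exs (xs i) (\<phi> i)))"
| Pi_step: "(\<And>i. \<exists>\<beta>. \<beta> <o \<alpha> \<and> Sigma_in \<beta> (\<phi> i)) \<Longrightarrow> Pi_in \<alpha> (Conj (\<lambda>i. alls (xs i) (\<phi> i)))"

datatype cclass = SigmaIn "nat rel" | PiIn "nat rel" | dSigmaIn "nat rel"

fun cclass_index :: "cclass \<Rightarrow> nat rel" where
  "cclass_index (SigmaIn \<alpha>) = \<alpha>"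
| "cclass_index (PiIn \<alpha>) = \<alpha>"
| "cclass_index (dSigmaIn \<alpha>) = \<alpha>"

definition complexity_class :: "cclass \<Rightarrow> bool" where
  "complexity_class \<Gamma> \<longleftrightarrow> Well_order (cclass_index \<Gamma>) \<and> natLeq_on 1 \<le>o cclass_index \<Gamma>"

fun cclass_formulas :: "cclass \<Rightarrow> fm set" where
  "cclass_formulas (SigmaIn \<alpha>) = {\<phi>. Sigma_in \<alpha> \<phi> \<and> finite (fv \<phi>)}"
| "cclass_formulas (PiIn \<alpha>) = {\<phi>. Pi_in \<alpha> \<phi> \<and> finite (fv \<phi>)}"
| "cclass_formulas (dSigmaIn \<alpha>) =
    {And \<phi> \<psi> |\<phi> \<psi>. Sigma_in \<alpha> \<phi> \<and> Pi_in \<alpha> \<psi> \<and> finite (fv \<phi>) \<and> finite (fv \<psi>)}"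

text \<open>As usual in first-order logic, structures are nonempty.\<close>

definition countable_structure :: "'a set \<Rightarrow> 'a rel \<Rightarrow> bool" where
  "countable_structure A R \<longleftrightarrow> countable A \<and> A \<noteq> {} \<and> R \<subseteq> A \<times> A"

definition countable_linear_ordering :: "'a set \<Rightarrow> 'a rel \<Rightarrow> bool" where
  "countable_linear_ordering A R \<longleftrightarrow> countable_structure A R \<and> linear_order_on A R"

definition isomorphic :: "'a set \<Rightarrow> 'a rel \<Rightarrow> 'b set \<Rightarrow> 'b rel \<Rightarrow> bool" where
  "isomorphic A R B S \<longleftrightarrow>
    (\<exists>f. bij_betw f A B \<and> (\<forall>x\<in>A. \<forall>y\<in>A. (x, y) \<in> R \<longleftrightarrow> (f x, f y) \<in> S))"

definition models :: "'a set \<Rightarrow> 'a rel \<Rightarrow> fm \<Rightarrow> bool" where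
  "models A R \<phi> \<longleftrightarrow> (\<forall>v. range v \<subseteq> A \<longrightarrow> sat A R \<phi> v)"

text \<open>
  Every countable structure has an isomorphic copy whose domain is a set of natural numbers, so
  quantifying over structures with domain in \<open>nat\<close> amounts to quantifying over all countable
  structures. For logical equivalence this loses nothing either, by the downward
  Loewenheim-Skolem theorem for \<open>L\<^bsub>\<omega>\<^sub>1\<omega>\<^esub>\<close>.
\<close>

definition scott_sentence :: "'a set \<Rightarrow> 'a rel \<Rightarrow> fm \<Rightarrow> bool" where
  "scott_sentence A R \<phi> \<longleftrightarrow>
    fv \<phi> = {} \<and>
    (\<forall>(B :: nat set) S. countable_structure B S \<longrightarrow> (models B S \<phi> \<longleftrightarrow> isomorphic A R B S))"

definition equivalent :: "fm \<Rightarrow> fm \<Rightarrow> bool" where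
  "equivalent \<phi> \<psi> \<longleftrightarrow>
    (\<forall>(B :: nat set) S v. countable_structure B S \<longrightarrow> range v \<subseteq> B \<longrightarrow>
      (sat B S \<phi> v \<longleftrightarrow> sat B S \<psi> v))"

definition cclass_le :: "cclass \<Rightarrow> cclass \<Rightarrow> bool" where
  "cclass_le \<Gamma> \<Delta> \<longleftrightarrow> (\<forall>\<phi>\<in>cclass_formulas \<Gamma>. \<exists>\<psi>\<in>cclass_formulas \<Delta>. equivalent \<phi> \<psi>)"

definition has_scott_sentence_in :: "'a set \<Rightarrow> 'a rel \<Rightarrow> cclass \<Rightarrow> bool" where
  "has_scott_sentence_in A R \<Gamma> \<longleftrightarrow> (\<exists>\<phi>\<in>cclass_formulas \<Gamma>. scott_sentence A R \<phi>)"

text \<open>\<open>has_SSC A R \<Gamma>\<close> says that \<open>SSC(A, R) = \<Gamma>\<close>; a least class is determined up to equivalence.\<close>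

definition has_SSC :: "'a set \<Rightarrow> 'a rel \<Rightarrow> cclass \<Rightarrow> bool" where
  "has_SSC A R \<Gamma> \<longleftrightarrow>
    complexity_class \<Gamma> \<and> has_scott_sentence_in A R \<Gamma> \<and>
    (\<forall>\<Delta>. complexity_class \<Delta> \<and> has_scott_sentence_in A R \<Delta> \<longrightarrow> cclass_le \<Gamma> \<Delta>)"

end

theory Submission
  imports Defs Complex_Main
begin

text \<open>
  A \<open>\<Sigma>\<^sub>3\<close> Scott sentence of a linear order \<open>A\<close> yields a finite tuple satisfying a \<open>\<Pi>\<^sub>2\<close> formula that
  forces any countable structure to be isomorphic to \<open>A\<close>. Enlarge the tuple so that it cuts \<open>A\<close> into
  intervals that are empty or infinite. Every infinite linear order satisfies only \<open>\<Pi>\<^sub>2\<close> sentences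
  that hold in the rationals, so replacing the infinite intervals by dense orders without endpoints
  preserves the \<open>\<Pi>\<^sub>2\<close> formula, and \<open>A\<close> is a finite sum of points and dense orders. For a cutting
  tuple of minimal length every entry borders an empty interval, so that the order type of the
  tuple together with the list of empty intervals determines it uniquely; this makes ``some tuple
  has these empty intervals, and every such tuple has dense intervals elsewhere'' a \<open>\<Pi>\<^sub>3\<close> Scott
  sentence. That \<open>\<Sigma>\<^sub>3\<close> is not contained in \<open>\<Pi>\<^sub>3\<close> is witnessed by \<open>\<omega> + \<omega>\<close> and \<open>\<omega>\<close>.
\<close>

section \<open>Levels of the hierarchy and satisfaction\<close>

text \<open>The obstacle in passing to the rationals is that an infinite interval may break into
  finite pieces once a point is chosen, as \<omega> does, so "infinite" is no invariant of the game.
  A \<open>\<Pi>\<^sub>2\<close> transfer, however, opens with one finite challenge from the dense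
  side, whose size is known beforehand; the given order needs room for that many points only, which
  is what \<open>large\<close> measures. The second challenge comes from the given order, and dense
  intervals can answer anything. The isomorphism with a countable model of the
  \<open>\<Pi>\<^sub>3\<close> sentence is not built by an infinite back-and-forth: the
  \<open>\<Pi>\<^sub>2\<close> formula is transferred to that model as well, and its defining
  property supplies the isomorphism. The strictness example is called for because a least class is
  compared with other classes as a set of formulas up to equivalence.\<close>

lemma ordLess_finite_card_less:
  assumes "\<beta> <o \<alpha>" "finite (Field \<alpha>)"
  shows "finite (Field \<beta>) \<and> card (Field \<beta>) < card (Field \<alpha>)"
proof -
  obtain f where wo: "Well_order \<beta>" and "embedS \<beta> \<alpha> f"
    using assms(1) unfolding ordLess_def by auto
  then have e: "embed \<beta> \<alpha> f" "\<not> bij_betw f (Field \<beta>) (Field \<alpha>)"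
    unfolding embedS_def by auto
  have inj: "inj_on f (Field \<beta>)" by (rule embed_inj_on[OF wo e(1)])
  have "f ` Field \<beta> \<subseteq> Field \<alpha>" by (rule embed_Field[OF e(1)])
  then have sub: "f ` Field \<beta> \<subset> Field \<alpha>" using e(2) inj by (auto simp: bij_betw_def)
  then have "finite (f ` Field \<beta>)" using assms(2) finite_subset by blast
  then show ?thesis
    using psubset_card_mono[OF assms(2) sub] inj by (simp add: card_image finite_image_iff)
qed

lemma natLeq_on_ordLess:
  assumes "m < n"
  shows "natLeq_on m <o natLeq_on n"
proof -
  have "\<not> natLeq_on n \<le>o natLeq_on m"
  proof
    assume "natLeq_on n \<le>o natLeq_on m"
    then obtain f where f: "embed (natLeq_on n) (natLeq_on m) f" unfolding ordLeq_def by auto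
    have "card (Field (natLeq_on n)) \<le> card (Field (natLeq_on m))"
      using embed_inj_on[OF natLeq_on_Well_order f] embed_Field[OF f]
      by (rule card_inj_on_le) (simp add: Field_natLeq_on)
    then show False using assms by (simp add: Field_natLeq_on)
  qed
  then show ?thesis
    using not_ordLeq_iff_ordLess[OF natLeq_on_Well_order natLeq_on_Well_order] by blast
qed

lemma empty_ordLess_natLeq_on:
  assumes "0 < n"
  shows "({} :: nat rel) <o natLeq_on n"
proof -
  have "natLeq_on 0 = {}" by simp
  then show ?thesis using natLeq_on_ordLess[OF assms] by (simp only:)
qed

section \<open>Quantifier blocks, free variables and invariance under isomorphism\<close>

lemma sat_alls:
  "sat A R (alls xs \<phi>) v \<longleftrightarrow>
    (\<forall>v'. (\<forall>m\<in>set xs. v' m \<in> A) \<longrightarrow> (\<forall>m. m \<notin> set xs \<longrightarrow> v' m = v m) \<longrightarrow> sat A R \<phi> v')"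
proof (induction xs arbitrary: v)
  case Nil
  have "v' = v" if "\<forall>m. v' m = v m" for v' using that by auto
  then show ?case by (auto simp: alls_def)
next
  case (Cons a xs)
  have "sat A R (alls (a # xs) \<phi>) v \<longleftrightarrow> (\<forall>x\<in>A. sat A R (alls xs \<phi>) (v(a := x)))"
    by (simp add: alls_def)
  also have "\<dots> \<longleftrightarrow> (\<forall>v'. (\<forall>m\<in>set (a # xs). v' m \<in> A) \<longrightarrow>
      (\<forall>m. m \<notin> set (a # xs) \<longrightarrow> v' m = v m) \<longrightarrow> sat A R \<phi> v')" (is "?l = ?r")
  proof
    assume l: ?l
    show ?r
    proof (intro allI impI)
      fix v' assume v': "\<forall>m\<in>set (a # xs). v' m \<in> A" "\<forall>m. m \<notin> set (a # xs) \<longrightarrow> v' m = v m"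
      then have "sat A R (alls xs \<phi>) (v(a := v' a))" using l by simp
      then show "sat A R \<phi> v'" unfolding Cons.IH using v' by auto
    qed
  next
    assume r: ?r
    show ?l unfolding Cons.IH
    proof (intro ballI allI impI)
      fix x v' assume "x \<in> A" and v': "\<forall>m\<in>set xs. v' m \<in> A"
        "\<forall>m. m \<notin> set xs \<longrightarrow> v' m = (v(a := x)) m"
      \<comment> \<open>If \<open>a\<close> occurs again in \<open>xs\<close>, the inner quantifier
        has overwritten \<open>x\<close>, but with a value in \<open>A\<close>.\<close>
      have "v' a \<in> A" using v' \<open>x \<in> A\<close> by (cases "a \<in> set xs") auto
      then show "sat A R \<phi> v'" using r v' by auto
    qed
  qed
  finally show ?case .
qed

lemma sat_Neg_exs: "sat A R (exs xs \<phi>) v \<longleftrightarrow> \<not> sat A R (alls xs (Neg \<phi>)) v"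
proof (induction xs arbitrary: v)
  case (Cons a xs)
  then show ?case by (simp add: exs_def alls_def fun_upd_def)
qed (simp add: exs_def alls_def)

lemma sat_exs:
  "sat A R (exs xs \<phi>) v \<longleftrightarrow>
    (\<exists>v'. (\<forall>m\<in>set xs. v' m \<in> A) \<and> (\<forall>m. m \<notin> set xs \<longrightarrow> v' m = v m) \<and> sat A R \<phi> v')"
  unfolding sat_Neg_exs sat_alls by auto

lemma fv_exs [simp]: "fv (exs xs \<phi>) = fv \<phi> - set xs"
  by (induction xs) (auto simp: exs_def)

lemma fv_alls [simp]: "fv (alls xs \<phi>) = fv \<phi> - set xs"
  by (induction xs) (auto simp: alls_def)

lemma sat_cong_fv: "(\<And>m. m \<in> fv \<phi> \<Longrightarrow> v m = w m) \<Longrightarrow> sat A R \<phi> v = sat A R \<phi> w"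
proof (induction \<phi> arbitrary: v w)
  case (Conj \<Phi>)
  have "sat A R (\<Phi> i) v = sat A R (\<Phi> i) w" for i
    by (rule Conj.IH[OF rangeI]) (use Conj.prems in force)
  then show ?case by simp
next
  case (Disj \<Phi>)
  have "sat A R (\<Phi> i) v = sat A R (\<Phi> i) w" for i
    by (rule Disj.IH[OF rangeI]) (use Disj.prems in force)
  then show ?case by simp
next
  case (Ex n \<phi>)
  have "sat A R \<phi> (v(n := x)) = sat A R \<phi> (w(n := x))" for x
    by (intro Ex.IH) (use Ex.prems in simp)
  then show ?case by simp
next
  case (All n \<phi>)
  have "sat A R \<phi> (v(n := x)) = sat A R \<phi> (w(n := x))" for x
    by (intro All.IH) (use All.prems in simp)
  then show ?case by simp
next
  case (Neg \<phi>)
  have "sat A R \<phi> v = sat A R \<phi> w" by (intro Neg.IH) (use Neg.prems in simp)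
  then show ?case by simp
next
  case (And \<phi> \<psi>)
  have "sat A R \<phi> v = sat A R \<phi> w" "sat A R \<psi> v = sat A R \<psi> w"
    using And.prems by (auto intro!: And.IH)
  then show ?case by simp
next
  case (Or \<phi> \<psi>)
  have "sat A R \<phi> v = sat A R \<phi> w" "sat A R \<psi> v = sat A R \<psi> w"
    using Or.prems by (auto intro!: Or.IH)
  then show ?case by simp
qed auto

lemma sat_iso:
  assumes f: "bij_betw f A B" "\<forall>x\<in>A. \<forall>y\<in>A. (x, y) \<in> R \<longleftrightarrow> (f x, f y) \<in> S"
    and "range v \<subseteq> A"
  shows "sat A R \<phi> v \<longleftrightarrow> sat B S \<phi> (f \<circ> v)"
  using assms(3)
proof (induction \<phi> arbitrary: v)
  case (Eq m n)
  then have "v m \<in> A" "v n \<in> A" by auto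
  then show ?case using f(1) by (auto simp: bij_betw_def inj_on_def)
next
  case (Le m n)
  then have "v m \<in> A" "v n \<in> A" by auto
  then show ?case using f(2) by auto
next
  case (Ex n \<phi>)
  have "sat A R \<phi> (v(n := x)) = sat B S \<phi> ((f \<circ> v)(n := f x))" if "x \<in> A" for x
    proof -
    have "range (v(n := x)) \<subseteq> A" using Ex.prems that by auto
    moreover have "f \<circ> v(n := x) = (f \<circ> v)(n := f x)" by auto
    ultimately show ?thesis using Ex.IH by metis
  qed
  moreover have "f ` A = B" using f(1) by (simp add: bij_betw_def)
  ultimately show ?case by (auto simp del: o_apply)
next
  case (All n \<phi>)
  have "sat A R \<phi> (v(n := x)) = sat B S \<phi> ((f \<circ> v)(n := f x))" if "x \<in> A" for x
    proof -
    have "range (v(n := x)) \<subseteq> A" using All.prems that by auto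
    moreover have "f \<circ> v(n := x) = (f \<circ> v)(n := f x)" by auto
    ultimately show ?thesis using All.IH by metis
  qed
  moreover have "f ` A = B" using f(1) by (simp add: bij_betw_def)
  ultimately show ?case by (auto simp del: o_apply)
qed auto

lemma isomorphic_sym: "isomorphic A R B S \<Longrightarrow> isomorphic B S A R"
proof -
  assume "isomorphic A R B S"
  then obtain f where f: "bij_betw f A B" "\<forall>x\<in>A. \<forall>y\<in>A. (x, y) \<in> R \<longleftrightarrow> (f x, f y) \<in> S"
    unfolding isomorphic_def by auto
  have "bij_betw (inv_into A f) B A" using f(1) by (rule bij_betw_inv_into)
  moreover have "\<forall>x\<in>B. \<forall>y\<in>B. (x, y) \<in> S \<longleftrightarrow> (inv_into A f x, inv_into A f y) \<in> R"
    using f bij_betw_inv_into_right[OF f(1)] bij_betwE[OF calculation] by simp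
  ultimately show ?thesis unfolding isomorphic_def by auto
qed

lemma isomorphic_trans: "isomorphic A R B S \<Longrightarrow> isomorphic B S C T \<Longrightarrow> isomorphic A R C T"
  unfolding isomorphic_def
  apply (elim exE conjE)
  subgoal for f g by (intro exI[of _ "g \<circ> f"]) (auto simp: bij_betw_trans dest: bij_betwE)
  done

lemma isomorphic_refl: "isomorphic A R A R"
  unfolding isomorphic_def by (intro exI[of _ id]) auto

lemma models_isomorphic:
  assumes "isomorphic A R B S" "models A R \<phi>"
  shows "models B S \<phi>"
  unfolding models_def
proof (intro allI impI)
  fix w :: "nat \<Rightarrow> 'b" assume w: "range w \<subseteq> B"
  obtain f where f: "bij_betw f B A" "\<forall>x\<in>B. \<forall>y\<in>B. (x, y) \<in> S \<longleftrightarrow> (f x, f y) \<in> R"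
    using isomorphic_sym[OF assms(1)] unfolding isomorphic_def by auto
  have "range (f \<circ> w) \<subseteq> A" using w f(1) by (auto dest: bij_betwE)
  then show "sat B S \<phi> w"
    using assms(2) sat_iso[OF f w] unfolding models_def by auto
qed

lemma models_sentence_iff:
  assumes "fv \<phi> = {}" "range v \<subseteq> A"
  shows "models A R \<phi> \<longleftrightarrow> sat A R \<phi> v"
proof -
  have "sat A R \<phi> w = sat A R \<phi> v" for w
    using assms(1) by (intro sat_cong_fv) auto
  then show ?thesis unfolding models_def using assms(2) by blast
qed

lemma scott_sentence_isomorphic:
  assumes "isomorphic A R B S"
  shows "scott_sentence A R \<phi> \<longleftrightarrow> scott_sentence B S \<phi>"
proof -
  have "isomorphic A R C T \<longleftrightarrow> isomorphic B S C T" for C :: "nat set" and T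
    using isomorphic_trans[OF isomorphic_sym[OF assms], of C T] isomorphic_trans[OF assms, of C T]
    by blast
  then show ?thesis unfolding scott_sentence_def by simp
qed

lemma linear_order_on_isomorphic:
  assumes "isomorphic A R B S" "linear_order_on A R" "S \<subseteq> B \<times> B"
  shows "linear_order_on B S"
proof -
  obtain f where f: "bij_betw f B A" "\<forall>x\<in>B. \<forall>y\<in>B. (x, y) \<in> S \<longleftrightarrow> (f x, f y) \<in> R"
    using isomorphic_sym[OF assms(1)] unfolding isomorphic_def by auto
  have fA: "f x \<in> A" if "x \<in> B" for x using f(1) that by (auto dest: bij_betwE)
  have inj: "f x = f y \<longleftrightarrow> x = y" if "x \<in> B" "y \<in> B" for x y
    using f(1) that by (auto simp: bij_betw_def inj_on_def)
  have R: "\<forall>x\<in>A. (x, x) \<in> R" "trans R" "antisym R"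
    "\<forall>x\<in>A. \<forall>y\<in>A. x \<noteq> y \<longrightarrow> (x, y) \<in> R \<or> (y, x) \<in> R"
    using assms(2) by (auto simp: order_on_defs refl_on_def total_on_def)
  have "refl_on B S" using assms(3) f(2) fA R(1) by (auto simp: refl_on_def)
  moreover have "trans S"
  proof (rule transI)
    fix x y z assume h: "(x, y) \<in> S" "(y, z) \<in> S"
    then have "x \<in> B" "y \<in> B" "z \<in> B" using assms(3) by auto
    then show "(x, z) \<in> S" using h f(2) transD[OF R(2)] by blast
  qed
  moreover have "antisym S"
  proof (rule antisymI)
    fix x y assume h: "(x, y) \<in> S" "(y, x) \<in> S"
    then have "x \<in> B" "y \<in> B" using assms(3) by auto
    then show "x = y" using h f(2) antisymD[OF R(3)] inj by blast
  qed
  moreover have "total_on B S" unfolding total_on_def using f(2) fA R(4) inj by metis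
  ultimately show ?thesis using assms(3) by (simp add: order_on_defs)
qed

text \<open>Scott sentences are tested on domains inside \<open>nat\<close>, and later the points of
  the order serve as indices of families; both call for a copy in \<open>nat\<close>.\<close>

lemma obtain_nat_copy:
  assumes "countable_structure A R"
  obtains B :: "nat set" and S where "countable_structure B S" "isomorphic A R B S"
proof
  define f where "f = to_nat_on A"
  have inj: "inj_on f A" using assms unfolding f_def countable_structure_def by auto
  let ?S = "{(f x, f y) | x y. (x, y) \<in> R}"
  show "countable_structure (f ` A) ?S"
    using assms unfolding countable_structure_def by auto
  show "isomorphic A R (f ` A) ?S"
    unfolding isomorphic_def
  proof (intro exI conjI ballI)
    show "bij_betw f A (f ` A)" using inj by (simp add: bij_betw_def)
    show "(x, y) \<in> R \<longleftrightarrow> (f x, f y) \<in> ?S" if "x \<in> A" "y \<in> A" for x y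
      using that inj assms unfolding countable_structure_def inj_on_def by blast
  qed
qed

text \<open>
  The standard back-and-forth relations: \<open>bf k\<close> says that the \<open>\<Pi>\<^sub>k\<close> formulas true of \<open>v\<close> in \<open>(A, R)\<close>
  are true of \<open>w\<close> in \<open>(B, S)\<close>.
\<close>

primrec bf :: "nat \<Rightarrow> 'a set \<Rightarrow> 'a rel \<Rightarrow> (nat \<Rightarrow> 'a) \<Rightarrow> 'a set \<Rightarrow> 'a rel \<Rightarrow> (nat \<Rightarrow> 'a) \<Rightarrow> bool" where
  "bf 0 A R v B S w \<longleftrightarrow>
    (\<forall>m n. (v m = v n \<longleftrightarrow> w m = w n) \<and> ((v m, v n) \<in> R \<longleftrightarrow> (w m, w n) \<in> S))"
| "bf (Suc k) A R v B S w \<longleftrightarrow>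
    (\<forall>X w'. finite X \<longrightarrow> (\<forall>m\<in>X. w' m \<in> B) \<longrightarrow> (\<forall>m. m \<notin> X \<longrightarrow> w' m = w m) \<longrightarrow>
      (\<exists>v'. (\<forall>m\<in>X. v' m \<in> A) \<and> (\<forall>m. m \<notin> X \<longrightarrow> v' m = v m) \<and> bf k B S w' A R v'))"

text \<open>At the bottom the empty move \<open>X = {}\<close> is played, which forces
  \<open>v' = v\<close>; level 0 is symmetric in the two structures.\<close>

lemma bf_SucD: "bf (Suc k) A R v B S w \<Longrightarrow> bf k A R v B S w"
proof (induction k arbitrary: A R v B S w)
  case 0
  then obtain v' where "\<forall>m. v' m = v m" "bf 0 B S w A R v'"
    by (metis bf.simps(2) empty_iff finite.emptyI)
  moreover then have "v' = v" by auto
  ultimately show ?case by auto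
next
  case (Suc k)
  show ?case unfolding bf.simps(2)[of k]
  proof (intro allI impI)
    fix X w' assume "finite X" "\<forall>m\<in>X. w' m \<in> B" "\<forall>m. m \<notin> X \<longrightarrow> w' m = w m"
    then obtain v' where "\<forall>m\<in>X. v' m \<in> A" "\<forall>m. m \<notin> X \<longrightarrow> v' m = v m"
      "bf (Suc k) B S w' A R v'"
      using Suc.prems unfolding bf.simps(2)[of "Suc k"] by blast
    then show "\<exists>v'. (\<forall>m\<in>X. v' m \<in> A) \<and> (\<forall>m. m \<notin> X \<longrightarrow> v' m = v m) \<and> bf k B S w' A R v'"
      using Suc.IH by blast
  qed
qed

lemma bf_0: "bf k A R v B S w \<Longrightarrow> bf 0 A R v B S w"
proof (induction k)
  case (Suc k)
  then show ?case using bf_SucD by blast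
qed

lemma sat_qfree_bf_0: "qfree \<phi> \<Longrightarrow> bf 0 A R v B S w \<Longrightarrow> sat A R \<phi> v \<longleftrightarrow> sat B S \<phi> w"
proof (induction rule: qfree.induct)
  case (1 m n)
  then show ?case by simp
next
  case (2 m n)
  then show ?case by simp
qed simp_all

text \<open>The levels below a finite one are arbitrary finite well-orders, not just the relations
  \<open>natLeq_on n\<close>, so the induction is bounded by the size of the field. One move of
  \<open>bf\<close> answers one block of quantifiers; the two implications are proved together
  because each move swaps the structures.\<close>

lemma bf_transfer:
  assumes "bf k A R v B S w" "finite (Field \<alpha>)" "card (Field \<alpha>) \<le> k"
  shows "(Pi_in \<alpha> \<phi> \<and> sat A R \<phi> v \<longrightarrow> sat B S \<phi> w) \<and>
    (Sigma_in \<alpha> \<phi> \<and> sat B S \<phi> w \<longrightarrow> sat A R \<phi> v)"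
  using assms
proof (induction k arbitrary: A R v B S w \<alpha> \<phi>)
  case 0
  \<comment> \<open>Nothing lies below a level with empty field, so the step rules cannot apply and
    only quantifier-free formulas remain.\<close>
  have no: "\<not> \<beta> <o \<alpha>" for \<beta> :: "nat rel"
    using ordLess_finite_card_less[of \<beta> \<alpha>] 0 by auto
  have "qfree \<phi>" if "Pi_in \<alpha> \<phi>" using that by cases (use no in auto)
  moreover have "qfree \<phi>" if "Sigma_in \<alpha> \<phi>" using that by cases (use no in auto)
  ultimately show ?case using sat_qfree_bf_0[OF _ 0(1)] by blast
next
  case (Suc k)
  have sub: "finite (Field \<beta>)" "card (Field \<beta>) \<le> k" if "\<beta> <o \<alpha>" for \<beta> :: "nat rel"
    using ordLess_finite_card_less[OF that Suc.prems(2)] Suc.prems(3) by auto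
  note bf0 = bf_0[OF Suc.prems(1)]
  have step: "\<exists>v'. (\<forall>m\<in>X. v' m \<in> A) \<and> (\<forall>m. m \<notin> X \<longrightarrow> v' m = v m) \<and> bf k B S w' A R v'"
    if "finite X" "\<forall>m\<in>X. w' m \<in> B" "\<forall>m. m \<notin> X \<longrightarrow> w' m = w m" for X w'
    using Suc.prems(1) that unfolding bf.simps(2) by blast
  have "sat B S \<phi> w" if "Pi_in \<alpha> \<phi>" and sat: "sat A R \<phi> v"
    using that(1)
  proof cases
    case Pi_0
    then show ?thesis using sat_qfree_bf_0[OF _ bf0] sat by blast
  next
    case (Pi_step \<phi>' xs)
    have "sat B S (alls (xs i) (\<phi>' i)) w" for i
      unfolding sat_alls
    proof (intro allI impI)
      fix w' assume w': "\<forall>m\<in>set (xs i). w' m \<in> B" "\<forall>m. m \<notin> set (xs i) \<longrightarrow> w' m = w m"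
      obtain v' where v': "\<forall>m\<in>set (xs i). v' m \<in> A" "\<forall>m. m \<notin> set (xs i) \<longrightarrow> v' m = v m"
        "bf k B S w' A R v'"
        using step[OF finite_set w'] by blast
      obtain \<beta> where b: "\<beta> <o \<alpha>" "Sigma_in \<beta> (\<phi>' i)" using Pi_step(2) by blast
      have "sat A R (alls (xs i) (\<phi>' i)) v" using sat Pi_step(1) by simp
      then have "sat A R (\<phi>' i) v'" using v' unfolding sat_alls by blast
      then show "sat B S (\<phi>' i) w'" using Suc.IH[OF v'(3) sub[OF b(1)]] b(2) by blast
    qed
    then show ?thesis unfolding Pi_step by simp
  qed
  moreover have "sat A R \<phi> v" if "Sigma_in \<alpha> \<phi>" and sat: "sat B S \<phi> w"
    using that(1)
  proof cases
    case Sigma_0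
    then show ?thesis using sat_qfree_bf_0[OF _ bf0] sat by blast
  next
    case (Sigma_step \<phi>' xs)
    then obtain i where "sat B S (exs (xs i) (\<phi>' i)) w" using sat by auto
    then obtain w' where w': "\<forall>m\<in>set (xs i). w' m \<in> B" "\<forall>m. m \<notin> set (xs i) \<longrightarrow> w' m = w m"
      and sat': "sat B S (\<phi>' i) w'" unfolding sat_exs by blast
    obtain v' where v': "\<forall>m\<in>set (xs i). v' m \<in> A" "\<forall>m. m \<notin> set (xs i) \<longrightarrow> v' m = v m"
      "bf k B S w' A R v'"
      using step[OF finite_set w'] by blast
    obtain \<beta> where b: "\<beta> <o \<alpha>" "Pi_in \<beta> (\<phi>' i)" using Sigma_step(2) by blast
    have "sat A R (\<phi>' i) v'" using Suc.IH[OF v'(3) sub[OF b(1)]] b(2) sat' by blast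
    then have "sat A R (exs (xs i) (\<phi>' i)) v" unfolding sat_exs using v' by blast
    then show ?thesis unfolding Sigma_step by auto
  qed
  ultimately show ?case by blast
qed

section \<open>Gaps of finite families in linear orders\<close>

definition lt :: "'a rel \<Rightarrow> 'a \<Rightarrow> 'a \<Rightarrow> bool" where
  "lt R x y \<longleftrightarrow> (x, y) \<in> R \<and> x \<noteq> y"

definition lower :: "'a rel \<Rightarrow> 'a set \<Rightarrow> 'a \<Rightarrow> 'a set" where
  "lower R X x = {z \<in> X. lt R z x}"

definition upper :: "'a rel \<Rightarrow> 'a set \<Rightarrow> 'a \<Rightarrow> 'a set" where
  "upper R X x = {z \<in> X. lt R x z}"

text \<open>
  The set \<open>C\<close> collects the indices of the entries below the gap; only \<open>C \<inter> I\<close> matters, and the gap is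
  empty if \<open>C\<close> is not an initial segment of the family.
\<close>

definition gap :: "'a set \<Rightarrow> 'a rel \<Rightarrow> nat set \<Rightarrow> (nat \<Rightarrow> 'a) \<Rightarrow> nat set \<Rightarrow> 'a set" where
  "gap A R I c C = {x \<in> A. \<forall>i\<in>I. if i \<in> C then lt R (c i) x else lt R x (c i)}"

text \<open>
  The flags \<open>p\<close> and \<open>q\<close> switch the two bounds on or off, so that this includes being nonempty and
  having no endpoints.
\<close>

definition dense_set :: "'a rel \<Rightarrow> 'a set \<Rightarrow> bool" where
  "dense_set R X \<longleftrightarrow> (\<forall>p q x y. (p \<longrightarrow> x \<in> X) \<longrightarrow> (q \<longrightarrow> y \<in> X) \<longrightarrow> (p \<and> q \<longrightarrow> lt R x y) \<longrightarrow>
    (\<exists>z\<in>X. (p \<longrightarrow> lt R x z) \<and> (q \<longrightarrow> lt R z y)))"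

text \<open>Survives \<open>n\<close> rounds of splitting at a point chosen in each part.\<close>

primrec large :: "'a rel \<Rightarrow> nat \<Rightarrow> 'a set \<Rightarrow> bool" where
  "large R 0 X \<longleftrightarrow> True"
| "large R (Suc n) X \<longleftrightarrow> (\<exists>x\<in>X. large R n (lower R X x) \<and> large R n (upper R X x))"

lemma dense_setD:
  assumes "dense_set R X" "p \<Longrightarrow> x \<in> X" "q \<Longrightarrow> y \<in> X" "p \<Longrightarrow> q \<Longrightarrow> lt R x y"
  shows "\<exists>z\<in>X. (p \<longrightarrow> lt R x z) \<and> (q \<longrightarrow> lt R z y)"
  using assms unfolding dense_set_def by blast

lemma dense_set_nonempty: "dense_set R X \<Longrightarrow> X \<noteq> {}"
  using dense_setD[of R X False _ False] by blast

lemma large_mono: "large R n T \<Longrightarrow> T \<subseteq> X \<Longrightarrow> large R n X"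
proof (induction n arbitrary: T X)
  case (Suc n)
  then obtain x where x: "x \<in> T" "large R n (lower R T x)" "large R n (upper R T x)" by auto
  have "lower R T x \<subseteq> lower R X x" "upper R T x \<subseteq> upper R X x"
    using Suc.prems(2) by (auto simp: lower_def upper_def)
  then show ?case using Suc.IH x Suc.prems(2) unfolding large.simps by blast
qed simp

lemma large_SucD: "large R (Suc n) X \<Longrightarrow> large R n X"
proof (induction n arbitrary: X)
  case (Suc n)
  then obtain x where "x \<in> X" "large R (Suc n) (lower R X x)" "large R (Suc n) (upper R X x)"
    unfolding large.simps(2)[of R "Suc n"] by blast
  then show ?case using Suc.IH unfolding large.simps(2)[of R n] by blast
qed simp

lemma gap_cong: "D \<inter> I = C \<inter> I \<Longrightarrow> gap A R I a D = gap A R I a C"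
  unfolding gap_def by (intro Collect_cong conj_cong refl ball_cong if_cong) auto

lemma gap_subset: "gap A R I a C \<subseteq> A"
  by (auto simp: gap_def)

lemma gap_insert:
  assumes "j \<notin> I"
  shows "gap A R (insert j I) (a(j := x)) D =
    (if j \<in> D then upper R (gap A R I a D) x else lower R (gap A R I a D) x)"
proof -
  have "(\<forall>i\<in>insert j I. if i \<in> D then lt R ((a(j := x)) i) z else lt R z ((a(j := x)) i)) \<longleftrightarrow>
    (if j \<in> D then lt R x z else lt R z x) \<and> (\<forall>i\<in>I. if i \<in> D then lt R (a i) z else lt R z (a i))"
    for z
  proof -
    have "(a(j := x)) i = a i" if "i \<in> I" for i using assms that by auto
    then show ?thesis by simp
  qed
  then show ?thesis unfolding gap_def upper_def lower_def by auto
qed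

section \<open>Density, ranks and largeness in a linear order\<close>

locale linord =
  fixes A :: "'a set" and R :: "'a rel"
  assumes lin: "linear_order_on A R"
begin

lemma R_subset: "R \<subseteq> A \<times> A"
  using lin by (auto simp: order_on_defs refl_on_def)

lemma R_refl: "x \<in> A \<Longrightarrow> (x, x) \<in> R"
  using lin by (auto simp: order_on_defs refl_on_def)

lemma R_trans: "(x, y) \<in> R \<Longrightarrow> (y, z) \<in> R \<Longrightarrow> (x, z) \<in> R"
  using lin by (auto simp: order_on_defs dest: transD)

lemma R_antisym: "(x, y) \<in> R \<Longrightarrow> (y, x) \<in> R \<Longrightarrow> x = y"
  using lin by (auto simp: order_on_defs dest: antisymD)

lemma lt_total: "x \<in> A \<Longrightarrow> y \<in> A \<Longrightarrow> x \<noteq> y \<Longrightarrow> lt R x y \<or> lt R y x"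
  using lin by (auto simp: order_on_defs total_on_def lt_def)

lemma lt_trans: "lt R x y \<Longrightarrow> lt R y z \<Longrightarrow> lt R x z"
  unfolding lt_def using R_trans R_antisym by blast

lemma lt_irrefl: "\<not> lt R x x"
  by (simp add: lt_def)

lemma lt_asym: "lt R x y \<Longrightarrow> \<not> lt R y x"
  using lt_trans lt_irrefl by blast

lemma lt_in: "lt R x y \<Longrightarrow> x \<in> A \<and> y \<in> A"
  using R_subset by (auto simp: lt_def)

lemma R_iff: "x \<in> A \<Longrightarrow> y \<in> A \<Longrightarrow> (x, y) \<in> R \<longleftrightarrow> \<not> lt R y x"
  using lt_total lt_asym R_refl by (metis lt_def)

text \<open>A request without lower bound in the upper part becomes a request above \<open>y\<close>
  in \<open>X\<close>.\<close>

lemma dense_set_upper: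
  assumes d: "dense_set R X" and y: "y \<in> X"
  shows "dense_set R (upper R X y)"
  unfolding dense_set_def
proof (intro allI impI)
  fix p q x' y'
  assume h: "p \<longrightarrow> x' \<in> upper R X y" "q \<longrightarrow> y' \<in> upper R X y" "p \<and> q \<longrightarrow> lt R x' y'"
  have "\<exists>z\<in>X. (True \<longrightarrow> lt R (if p then x' else y) z) \<and> (q \<longrightarrow> lt R z y')"
    using h y by (intro dense_setD[OF d]) (auto simp: upper_def)
  then obtain z where z: "z \<in> X" "lt R (if p then x' else y) z" "q \<longrightarrow> lt R z y'"
    by blast
  have "lt R y z"
  proof (cases p)
    case True
    then show ?thesis using z(2) h(1) lt_trans[of y x' z] by (simp add: upper_def)
  qed (use z(2) in simp)
  then show "\<exists>z\<in>upper R X y. (p \<longrightarrow> lt R x' z) \<and> (q \<longrightarrow> lt R z y')"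
    using z by (intro bexI[of _ z]) (auto simp: upper_def)
qed

lemma dense_set_lower:
  assumes d: "dense_set R X" and y: "y \<in> X"
  shows "dense_set R (lower R X y)"
  unfolding dense_set_def
proof (intro allI impI)
  fix p q x' y'
  assume h: "p \<longrightarrow> x' \<in> lower R X y" "q \<longrightarrow> y' \<in> lower R X y" "p \<and> q \<longrightarrow> lt R x' y'"
  have "\<exists>z\<in>X. (p \<longrightarrow> lt R x' z) \<and> (True \<longrightarrow> lt R z (if q then y' else y))"
    using h y by (intro dense_setD[OF d]) (auto simp: lower_def)
  then obtain z where z: "z \<in> X" "lt R z (if q then y' else y)" "p \<longrightarrow> lt R x' z"
    by blast
  have "lt R z y"
  proof (cases q)
    case True
    then show ?thesis using z(2) h(2) lt_trans[of z y' y] by (simp add: lower_def)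
  qed (use z(2) in simp)
  then show "\<exists>z\<in>lower R X y. (p \<longrightarrow> lt R x' z) \<and> (q \<longrightarrow> lt R z y')"
    using z by (intro bexI[of _ z]) (auto simp: lower_def)
qed

lemma dense_set_large: "dense_set R X \<Longrightarrow> large R n X"
proof (induction n arbitrary: X)
  case (Suc n)
  then obtain x where "x \<in> X" using dense_set_nonempty by blast
  then show ?case using Suc dense_set_upper dense_set_lower by auto
qed simp

lemma card_lower_strict:
  assumes "finite T" "x \<in> T" "lt R x y"
  shows "card (lower R T x) < card (lower R T y)"
proof (rule psubset_card_mono)
  show "finite (lower R T y)" using assms(1) by (simp add: lower_def)
  show "lower R T x \<subset> lower R T y"
  proof
    show "lower R T x \<subseteq> lower R T y" using assms(3) lt_trans by (auto simp: lower_def)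
    have "x \<in> lower R T y" "x \<notin> lower R T x" using assms lt_irrefl by (auto simp: lower_def)
    then show "lower R T x \<noteq> lower R T y" by blast
  qed
qed

lemma inj_on_card_lower:
  assumes "finite T" "T \<subseteq> A"
  shows "inj_on (\<lambda>x. card (lower R T x)) T"
proof (rule inj_onI, rule ccontr)
  fix x y assume h: "x \<in> T" "y \<in> T" "card (lower R T x) = card (lower R T y)" "x \<noteq> y"
  then have "lt R x y \<or> lt R y x" using lt_total assms(2) by blast
  then show False using card_lower_strict[OF assms(1)] h by fastforce
qed

text \<open>The ranks are distinct and smaller than \<open>card T\<close>, so by counting they take
  every such value.\<close>

lemma ex_card_lower:
  assumes "finite T" "T \<subseteq> A" "m < card T"
  shows "\<exists>x\<in>T. card (lower R T x) = m"
proof -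
  let ?f = "\<lambda>x. card (lower R T x)"
  have "?f x < card T" if "x \<in> T" for x
    using that assms(1) lt_irrefl by (intro psubset_card_mono) (auto simp: lower_def)
  then have "?f ` T \<subseteq> {..<card T}" by auto
  moreover have "card (?f ` T) = card {..<card T}"
    using inj_on_card_lower[OF assms(1,2)] by (simp add: card_image)
  ultimately have "?f ` T = {..<card T}" by (intro card_subset_eq) auto
  then have "m \<in> ?f ` T" using assms(3) by blast
  then show ?thesis by auto
qed

text \<open>The required size satisfies m(0) = 0 and m(n+1) = 2 m(n) + 1, hence is
  \<open>2 ^ n - 1\<close>; splitting at the element of rank \<open>2 ^ n - 1\<close> leaves enough
  on both sides.\<close>

lemma large_if_card:
  "finite T \<Longrightarrow> T \<subseteq> A \<Longrightarrow> 2 ^ n \<le> Suc (card T) \<Longrightarrow> large R n T"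
proof (induction n arbitrary: T)
  case (Suc n)
  have pos: "0 < (2::nat) ^ n" by simp
  have "2 ^ n - 1 < card T" using Suc.prems(3) pos unfolding power_Suc by linarith
  then obtain x where x: "x \<in> T" "card (lower R T x) = 2 ^ n - 1"
    using ex_card_lower Suc.prems by blast
  have "T = insert x (lower R T x \<union> upper R T x)"
    using x(1) Suc.prems(2) lt_total by (auto simp: lower_def upper_def)
  then have "card T = card (insert x (lower R T x \<union> upper R T x))" by simp
  also have "\<dots> \<le> Suc (card (lower R T x) + card (upper R T x))"
    using card_Un_le[of "lower R T x" "upper R T x"]
      card_insert_le_m1[of "Suc (card (lower R T x) + card (upper R T x))" "lower R T x \<union> upper R T x" x]
    by simp
  finally have "2 ^ n \<le> Suc (card (upper R T x))" using Suc.prems(3) x(2) pos by simp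
  moreover have "finite (lower R T x)" "finite (upper R T x)" "lower R T x \<subseteq> A" "upper R T x \<subseteq> A"
    using Suc.prems by (auto simp: lower_def upper_def)
  ultimately have "large R n (lower R T x)" "large R n (upper R T x)"
    using Suc.IH x(2) by auto
  then show ?case using x(1) by auto
qed simp

lemma large_infinite:
  assumes "infinite X" "X \<subseteq> A"
  shows "large R n X"
proof -
  obtain T where "finite T" "card T = 2 ^ n" "T \<subseteq> X"
    using infinite_arbitrarily_large[OF assms(1)] by blast
  then show ?thesis using large_if_card[of T n] large_mono assms(2) by fastforce
qed

text \<open>The entry \<open>a i\<close> separates the two gaps, so a point inserted into the gap of
  \<open>C\<close> leaves every other gap undivided.\<close>

lemma gap_halves:
  assumes x: "x \<in> gap A R I a C" and i: "i \<in> I" "(i \<in> C) \<noteq> (i \<in> D)"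
  shows "if i \<in> C
    then lower R (gap A R I a D) x = gap A R I a D \<and> upper R (gap A R I a D) x = {}
    else upper R (gap A R I a D) x = gap A R I a D \<and> lower R (gap A R I a D) x = {}"
proof (cases "i \<in> C")
  case True
  then have "lt R z x" if "z \<in> gap A R I a D" for z
    using x that i unfolding gap_def by (auto intro: lt_trans[of z "a i" x])
  then show ?thesis using True lt_asym by (auto simp: upper_def lower_def)
next
  case False
  then have "lt R x z" if "z \<in> gap A R I a D" for z
    using x that i unfolding gap_def by (auto intro: lt_trans[of x "a i" z])
  then show ?thesis using False lt_asym by (auto simp: upper_def lower_def)
qed

lemma gap_avoids: "x \<in> gap A R I a C \<Longrightarrow> i \<in> I \<Longrightarrow> x \<noteq> a i"
  using lt_irrefl by (auto simp: gap_def split: if_splits)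

lemma in_own_gap:
  assumes "x \<in> A" "a ` I \<subseteq> A" "x \<notin> a ` I"
  shows "x \<in> gap A R I a {i. lt R (a i) x}"
  unfolding gap_def using assms lt_total by fastforce

end

text \<open>The two sides play different roles. Nonempty gaps in \<open>B\<close> are dense and can
  answer any point; \<open>L\<close> records what the gaps of \<open>A\<close> must still withstand:
  \<open>large R n\<close> while points of \<open>B\<close> await an answer, no condition once only
  points of \<open>A\<close> are to be answered, and density when both orders have dense
  gaps.\<close>

definition matched :: "('a set \<Rightarrow> bool) \<Rightarrow> 'a set \<Rightarrow> 'a rel \<Rightarrow> 'b set \<Rightarrow> 'b rel \<Rightarrow>
    nat set \<Rightarrow> (nat \<Rightarrow> 'a) \<Rightarrow> (nat \<Rightarrow> 'b) \<Rightarrow> bool" where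
  "matched L A R B S I a b \<longleftrightarrow>
    finite I \<and> a ` I \<subseteq> A \<and> b ` I \<subseteq> B \<and>
    (\<forall>i\<in>I. \<forall>j\<in>I. (a i, a j) \<in> R \<longleftrightarrow> (b i, b j) \<in> S) \<and>
    (\<forall>C. gap A R I a C = {} \<and> gap B S I b C = {} \<or>
      L (gap A R I a C) \<and> dense_set S (gap B S I b C))"

lemma matched_mono:
  "matched L A R B S I a b \<Longrightarrow> (\<And>X. L X \<Longrightarrow> L' X) \<Longrightarrow> matched L' A R B S I a b"
  unfolding matched_def by blast

lemma matched_insert:
  assumes "linord A R" "linord B S" and m: "matched L A R B S I a b" and j: "j \<notin> I"
    and x: "x \<in> gap A R I a C" and y: "y \<in> gap B S I b C"
    and LL': "\<And>X. L X \<Longrightarrow> L' X"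
    and L': "L' (lower R (gap A R I a C) x)" "L' (upper R (gap A R I a C) x)"
  shows "matched L' A R B S (insert j I) (a(j := x)) (b(j := y))"
proof -
  interpret A: linord A R by fact
  interpret B: linord B S by fact
  have gaps: "gap A R I a D = {} \<and> gap B S I b D = {} \<or>
      L (gap A R I a D) \<and> dense_set S (gap B S I b D)" for D
    using m unfolding matched_def by blast
  have ord: "(a i, a k) \<in> R \<longleftrightarrow> (b i, b k) \<in> S" if "i \<in> I" "k \<in> I" for i k
    using m that unfolding matched_def by blast
  have in': "a i \<in> A" "b i \<in> B" if "i \<in> I" for i using m that unfolding matched_def by auto
  have xA: "x \<in> A" and yB: "y \<in> B" using x y by (auto simp: gap_def)
  have ordx: "(a i, x) \<in> R \<longleftrightarrow> (b i, y) \<in> S" "(x, a i) \<in> R \<longleftrightarrow> (y, b i) \<in> S" if "i \<in> I" for i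
    using x y that in'[OF that] xA yB A.R_iff B.R_iff A.lt_asym B.lt_asym
    unfolding gap_def by (cases "i \<in> C"; auto)+
  have dC: "dense_set S (gap B S I b C)" using gaps[of C] y by auto
  have "gap A R (insert j I) (a(j := x)) D = {} \<and> gap B S (insert j I) (b(j := y)) D = {} \<or>
      L' (gap A R (insert j I) (a(j := x)) D) \<and>
      dense_set S (gap B S (insert j I) (b(j := y)) D)" for D
  proof (cases "D \<inter> I = C \<inter> I")
    case True
    have "gap A R I a D = gap A R I a C" "gap B S I b D = gap B S I b C"
      by (rule gap_cong[OF True])+
    then show ?thesis
      using L' B.dense_set_upper[OF dC y] B.dense_set_lower[OF dC y]
      by (simp add: gap_insert[OF j])
  next
    case False
    \<comment> \<open>Any other gap lies on one side of the new point, the same side in both orders,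
      so one half is the whole gap and the other half is empty.\<close>
    then obtain i where i: "i \<in> I" "(i \<in> C) \<noteq> (i \<in> D)" by auto
    have 1: "if i \<in> C then lower R (gap A R I a D) x = gap A R I a D \<and> upper R (gap A R I a D) x = {}
        else upper R (gap A R I a D) x = gap A R I a D \<and> lower R (gap A R I a D) x = {}"
      using A.gap_halves[OF x i] .
    have 2: "if i \<in> C then lower S (gap B S I b D) y = gap B S I b D \<and> upper S (gap B S I b D) y = {}
        else upper S (gap B S I b D) y = gap B S I b D \<and> lower S (gap B S I b D) y = {}"
      using B.gap_halves[OF y i] .
    show ?thesis
      using 1 2 gaps[of D] LL' unfolding gap_insert[OF j] by (cases "i \<in> C"; cases "j \<in> D"; simp) blast+
  qed
  moreover have "\<forall>i\<in>insert j I. \<forall>k\<in>insert j I.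
      ((a(j := x)) i, (a(j := x)) k) \<in> R \<longleftrightarrow> ((b(j := y)) i, (b(j := y)) k) \<in> S"
    using ord ordx A.R_refl[OF xA] B.R_refl[OF yB] by auto
  ultimately show ?thesis
    using m xA yB unfolding matched_def by auto
qed

section \<open>Families with dense gaps and back-and-forth relations\<close>

text \<open>Level 0 of \<open>bf\<close> compares assignments on all variables, so both assignments
  must take their values, index by index, in the family.\<close>

definition covers :: "nat set \<Rightarrow> (nat \<Rightarrow> 'a) \<Rightarrow> (nat \<Rightarrow> 'b) \<Rightarrow> (nat \<Rightarrow> 'a) \<Rightarrow> (nat \<Rightarrow> 'b) \<Rightarrow> bool" where
  "covers I a b v w \<longleftrightarrow> (\<forall>m. \<exists>i\<in>I. v m = a i \<and> w m = b i)"

definition extends :: "nat set \<Rightarrow> (nat \<Rightarrow> 'a) \<Rightarrow> (nat \<Rightarrow> 'b) \<Rightarrow> nat set \<Rightarrow> (nat \<Rightarrow> 'a) \<Rightarrow> (nat \<Rightarrow> 'b) \<Rightarrow> bool" where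
  "extends I a b I' a' b' \<longleftrightarrow> I \<subseteq> I' \<and> (\<forall>i\<in>I. a' i = a i \<and> b' i = b i)"

lemma extends_refl: "extends I a b I a b"
  by (simp add: extends_def)

lemma extends_insert: "j \<notin> I \<Longrightarrow> extends I a b (insert j I) (a(j := x)) (b(j := y))"
  by (auto simp: extends_def)

lemma covers_upd:
  assumes "covers I a b v w" "extends I a b I' a' b'" "i \<in> I'"
  shows "covers I' a' b' (v(k := a' i)) (w(k := b' i))"
  unfolding covers_def
proof
  fix m
  obtain j where j: "j \<in> I" "v m = a j" "w m = b j" using assms(1) unfolding covers_def by blast
  show "\<exists>i'\<in>I'. (v(k := a' i)) m = a' i' \<and> (w(k := b' i)) m = b' i'"
  proof (cases "m = k")
    case True
    then show ?thesis using assms(3) by auto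
  next
    case False
    then show ?thesis using j assms(2) unfolding extends_def by (intro bexI[of _ j]) auto
  qed
qed

text \<open>A point of \<open>A\<close> outside the family falls into a gap whose partner is dense,
  and any point of the partner answers it. The position of the cut in \<open>A\<close> is dictated
  by \<open>p\<close>, so \<open>L\<close> has to survive every cut.\<close>

lemma matched_forth_point:
  assumes lo: "linord A R" "linord B S" and m: "matched L A R B S I a b" and p: "p \<in> A"
    and her: "\<forall>X x. L X \<longrightarrow> x \<in> X \<longrightarrow> L (lower R X x) \<and> L (upper R X x)"
  obtains I' a' b' i where "matched L A R B S I' a' b'" "extends I a b I' a' b'" "i \<in> I'" "a' i = p"
proof (cases "p \<in> a ` I")
  case True
  then show ?thesis using that[OF m extends_refl] by blast
next
  case False
  interpret A: linord A R by fact
  have fin: "finite I" and aI: "a ` I \<subseteq> A" using m unfolding matched_def by auto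
  obtain j where j: "j \<notin> I" using fin ex_new_if_finite infinite_UNIV_nat by blast
  define C where "C = {i. lt R (a i) p}"
  have pC: "p \<in> gap A R I a C" unfolding C_def by (rule A.in_own_gap[OF p aI False])
  then have L: "L (gap A R I a C)" and d: "dense_set S (gap B S I b C)"
    using m unfolding matched_def by (metis empty_iff)+
  obtain y where y: "y \<in> gap B S I b C" using dense_set_nonempty[OF d] by blast
  have "matched L A R B S (insert j I) (a(j := p)) (b(j := y))"
    using her L pC by (intro matched_insert[OF lo m j pC y]) auto
  then show ?thesis using that[OF _ extends_insert[OF j], of p y j] by auto
qed

text \<open>Here the cut in \<open>A\<close> can be chosen: the splitting point provided by
  \<open>large\<close> answers \<open>q\<close>, at the price of one level.\<close>

lemma matched_back_point:
  assumes lo: "linord A R" "linord B S" and m: "matched (large R (Suc n)) A R B S I a b" and q: "q \<in> B"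
  obtains I' a' b' i where "matched (large R n) A R B S I' a' b'" "extends I a b I' a' b'" "i \<in> I'" "b' i = q"
proof (cases "q \<in> b ` I")
  case True
  have "matched (large R n) A R B S I a b" using m large_SucD by (rule matched_mono)
  then show ?thesis using that[OF _ extends_refl] True by blast
next
  case False
  interpret B: linord B S by fact
  have fin: "finite I" and bI: "b ` I \<subseteq> B" using m unfolding matched_def by auto
  obtain j where j: "j \<notin> I" using fin ex_new_if_finite infinite_UNIV_nat by blast
  define C where "C = {i. lt S (b i) q}"
  have qC: "q \<in> gap B S I b C" unfolding C_def by (rule B.in_own_gap[OF q bI False])
  then have L: "large R (Suc n) (gap A R I a C)"
    using m unfolding matched_def by (metis empty_iff)
  then obtain x where x: "x \<in> gap A R I a C" "large R n (lower R (gap A R I a C) x)"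
    "large R n (upper R (gap A R I a C) x)" by auto
  have "matched (large R n) A R B S (insert j I) (a(j := x)) (b(j := q))"
    using large_SucD x(2,3) by (rule matched_insert[OF lo m j x(1) qC])
  then show ?thesis using that[OF _ extends_insert[OF j], of x q j] by auto
qed

lemma matched_forth:
  assumes lo: "linord A R" "linord B S" and m: "matched L A R B S I a b" and c: "covers I a b v w"
    and her: "\<forall>X x. L X \<longrightarrow> x \<in> X \<longrightarrow> L (lower R X x) \<and> L (upper R X x)"
    and X: "finite X" "\<forall>m\<in>X. v' m \<in> A" "\<forall>m. m \<notin> X \<longrightarrow> v' m = v m"
  shows "\<exists>I' a' b' w'. matched L A R B S I' a' b' \<and> covers I' a' b' v' w' \<and>
    (\<forall>m\<in>X. w' m \<in> B) \<and> (\<forall>m. m \<notin> X \<longrightarrow> w' m = w m)"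
  using X
proof (induction X arbitrary: v' rule: finite_induct)
  case empty
  then have "v' = v" by auto
  then show ?case using m c by auto
next
  case (insert k X)
  \<comment> \<open>The induction hypothesis is used with the change at \<open>k\<close> undone; the
    value \<open>v' k\<close> is then added as one more point.\<close>
  have "\<forall>m\<in>X. (v'(k := v k)) m \<in> A" "\<forall>m. m \<notin> X \<longrightarrow> (v'(k := v k)) m = v m"
    using insert by auto
  then obtain I' a' b' w' where IH: "matched L A R B S I' a' b'" "covers I' a' b' (v'(k := v k)) w'"
    "\<forall>m\<in>X. w' m \<in> B" "\<forall>m. m \<notin> X \<longrightarrow> w' m = w m"
    using insert.IH by blast
  have "v' k \<in> A" using insert.prems by simp
  then obtain I'' a'' b'' i where n: "matched L A R B S I'' a'' b''" "extends I' a' b' I'' a'' b''"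
    "i \<in> I''" "a'' i = v' k"
    using matched_forth_point[OF lo IH(1) _ her] by blast
  have "covers I'' a'' b'' (v'(k := v k, k := a'' i)) (w'(k := b'' i))"
    by (rule covers_upd[OF IH(2) n(2,3)])
  then have cov: "covers I'' a'' b'' v' (w'(k := b'' i))" by (simp add: n(4))
  have "b'' i \<in> B" using n unfolding matched_def by blast
  then have "(\<forall>m\<in>insert k X. (w'(k := b'' i)) m \<in> B) \<and>
      (\<forall>m. m \<notin> insert k X \<longrightarrow> (w'(k := b'' i)) m = w m)"
    using IH(3,4) by simp
  then show ?case using n(1) cov by blast
qed

text \<open>Each variable in \<open>X\<close> costs one level, so reaching \<open>n\<close> at the
  end requires level \<open>Suc n\<close> before the last variable. The start therefore has to be
  available at every level.\<close>

lemma matched_back: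
  assumes lo: "linord A R" "linord B S" and m: "\<And>n. matched (large R n) A R B S I a b" and c: "covers I a b v w"
    and X: "finite X" "\<forall>m\<in>X. w' m \<in> B" "\<forall>m. m \<notin> X \<longrightarrow> w' m = w m"
  shows "\<exists>I' a' b' v'. matched (large R n) A R B S I' a' b' \<and> covers I' a' b' v' w' \<and>
    (\<forall>m\<in>X. v' m \<in> A) \<and> (\<forall>m. m \<notin> X \<longrightarrow> v' m = v m)"
  using X
proof (induction X arbitrary: w' n rule: finite_induct)
  case empty
  then have "w' = w" by auto
  then show ?case using m c by auto
next
  case (insert k X)
  have "\<forall>m\<in>X. (w'(k := w k)) m \<in> B" "\<forall>m. m \<notin> X \<longrightarrow> (w'(k := w k)) m = w m"
    using insert by auto
  then obtain I' a' b' v' where IH: "matched (large R (Suc n)) A R B S I' a' b'"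
    "covers I' a' b' v' (w'(k := w k))"
    "\<forall>m\<in>X. v' m \<in> A" "\<forall>m. m \<notin> X \<longrightarrow> v' m = v m"
    using insert.IH by blast
  have "w' k \<in> B" using insert.prems by simp
  then obtain I'' a'' b'' i where n: "matched (large R n) A R B S I'' a'' b''"
    "extends I' a' b' I'' a'' b''" "i \<in> I''" "b'' i = w' k"
    using matched_back_point[OF lo IH(1)] by blast
  have "covers I'' a'' b'' (v'(k := a'' i)) (w'(k := w k, k := b'' i))"
    by (rule covers_upd[OF IH(2) n(2,3)])
  then have cov: "covers I'' a'' b'' (v'(k := a'' i)) w'" by (simp add: n(4))
  have "a'' i \<in> A" using n unfolding matched_def by blast
  then have "(\<forall>m\<in>insert k X. (v'(k := a'' i)) m \<in> A) \<and>
      (\<forall>m. m \<notin> insert k X \<longrightarrow> (v'(k := a'' i)) m = v m)"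
    using IH(3,4) by simp
  then show ?case using n(1) cov by blast
qed

lemma matched_bf_0:
  assumes "linord A R" "linord B S" "matched L A R B S I a b" "covers I a b v w"
  shows "bf 0 A R v B S w"
  unfolding bf.simps
proof (intro allI)
  fix m n
  interpret A: linord A R by fact
  interpret B: linord B S by fact
  obtain i j where ij: "i \<in> I" "j \<in> I" "v m = a i" "v n = a j" "w m = b i" "w n = b j"
    using assms(4) unfolding covers_def by meson
  have ord: "(a i, a j) \<in> R \<longleftrightarrow> (b i, b j) \<in> S" "(a j, a i) \<in> R \<longleftrightarrow> (b j, b i) \<in> S"
    and "a i \<in> A" "b i \<in> B"
    using assms(3) ij(1,2) unfolding matched_def by blast+
  then have "a i = a j \<longleftrightarrow> b i = b j"
    using A.R_antisym B.R_antisym A.R_refl B.R_refl by metis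
  then show "(v m = v n \<longleftrightarrow> w m = w n) \<and> ((v m, v n) \<in> R \<longleftrightarrow> (w m, w n) \<in> S)"
    using ord ij by simp
qed

text \<open>Finite extensions in \<open>A\<close> can be copied into the dense gaps of
  \<open>B\<close> whatever the gaps of \<open>A\<close> look like; thus universal facts pass from
  \<open>B\<close> to \<open>A\<close>.\<close>

lemma matched_bf_1:
  assumes "linord A R" "linord B S" "matched (\<lambda>_. True) A R B S I a b" "covers I a b v w"
  shows "bf (Suc 0) B S w A R v"
  unfolding bf.simps(2)
proof (intro allI impI)
  fix X v' assume "finite X" "\<forall>m\<in>X. v' m \<in> A" "\<forall>m. m \<notin> X \<longrightarrow> v' m = v m"
  then obtain I' a' b' w' where "matched (\<lambda>_. True) A R B S I' a' b'" "covers I' a' b' v' w'"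
    "\<forall>m\<in>X. w' m \<in> B" "\<forall>m. m \<notin> X \<longrightarrow> w' m = w m"
    using matched_forth[OF assms, of X v'] by blast
  then show "\<exists>w'. (\<forall>m\<in>X. w' m \<in> B) \<and> (\<forall>m. m \<notin> X \<longrightarrow> w' m = w m) \<and> bf 0 A R v' B S w'"
    using matched_bf_0[OF assms(1,2)] by blast
qed

text \<open>After the challenge from \<open>B\<close> is answered, level 0 of largeness is enough,
  since the remaining challenge comes from \<open>A\<close>.\<close>

lemma matched_bf_2:
  assumes "linord A R" "linord B S" "\<And>n. matched (large R n) A R B S I a b" "covers I a b v w"
  shows "bf (Suc (Suc 0)) A R v B S w"
  unfolding bf.simps(2)[of "Suc 0"]
proof (intro allI impI)
  fix X w' assume "finite X" "\<forall>m\<in>X. w' m \<in> B" "\<forall>m. m \<notin> X \<longrightarrow> w' m = w m"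
  then obtain I' a' b' v' where n: "matched (large R 0) A R B S I' a' b'" "covers I' a' b' v' w'"
    "\<forall>m\<in>X. v' m \<in> A" "\<forall>m. m \<notin> X \<longrightarrow> v' m = v m"
    using matched_back[OF assms, of X w' 0] by blast
  have "matched (\<lambda>_. True) A R B S I' a' b'" using n(1) by (rule matched_mono) simp
  then have "bf (Suc 0) B S w' A R v'" using matched_bf_1[OF assms(1,2) _ n(2)] by blast
  then show "\<exists>v'. (\<forall>m\<in>X. v' m \<in> A) \<and> (\<forall>m. m \<notin> X \<longrightarrow> v' m = v m) \<and> bf (Suc 0) B S w' A R v'"
    using n(3,4) by blast
qed

section \<open>Strictness of the hierarchy at level 3\<close>

definition Lt :: "nat \<Rightarrow> nat \<Rightarrow> fm" where
  "Lt m n = And (Le m n) (Neg (Eq m n))"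

lemma qfree_Lt [simp]: "qfree (Lt m n)"
  by (simp add: Lt_def qfree.intros)

lemma fv_Lt [simp]: "fv (Lt m n) = {m, n}"
  by (auto simp: Lt_def)

text \<open>The even numbers followed by the odd numbers.\<close>

definition two_omega :: "nat rel" where
  "two_omega = {(m, n). even m \<and> odd n \<or> even m = even n \<and> m \<le> n}"

text \<open>Universal facts pass to substructures: a tuple is answered by its image under
  \<open>g\<close>.\<close>

lemma bf_1_embedding:
  assumes "inj g" "\<And>x y. (g x, g y) \<in> R \<longleftrightarrow> (x, y) \<in> S"
  shows "bf (Suc 0) UNIV R (g \<circ> w) UNIV S w"
  unfolding bf.simps(2)
proof (intro allI impI)
  fix X and w' assume "\<forall>m. m \<notin> X \<longrightarrow> w' m = w m"
  then show "\<exists>v'. (\<forall>m\<in>X. v' m \<in> UNIV) \<and> (\<forall>m. m \<notin> X \<longrightarrow> v' m = (g \<circ> w) m) \<and> bf 0 UNIV S w' UNIV R v'"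
    using assms by (intro exI[of _ "g \<circ> w'"]) (simp add: inj_eq)
qed

text \<open>Finitely many points of \<omega> + \<omega> lie in a copy of \<omega> made of the first
  \<open>N\<close> even numbers followed by all odd numbers, because \<open>N\<close> + \<omega> =
  \<omega>. Universal facts pass down to this copy, which \<open>g\<close> enumerates.\<close>

lemma bf_2_omega:
  assumes "finite (range w)"
  shows "bf (Suc (Suc 0)) UNIV natLeq w UNIV two_omega (\<lambda>m. 2 * w m)"
  unfolding bf.simps(2)[of "Suc 0"]
proof (intro allI impI)
  fix X and v' assume X: "finite X" "\<forall>m. m \<notin> X \<longrightarrow> v' m = 2 * w m"
  have "range v' \<subseteq> v' ` X \<union> (\<lambda>m. 2 * m) ` range w" using X(2) by auto
  then have "finite (range v')" using X(1) assms finite_subset by blast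
  then obtain N where N: "\<And>m. v' m < N"
    using finite_nat_set_iff_bounded by (metis rangeI)
  define g where "g j = (if j < N then 2 * j else Suc (2 * (j - N)))" for j
  \<comment> \<open>The preimage of \<open>v'\<close> under \<open>g\<close>. Off \<open>X\<close>
    the value of \<open>v'\<close> is \<open>2 * w m\<close>, which is even, so \<open>w'\<close>
    agrees with \<open>w\<close> there.\<close>
  define w' where "w' m = (if even (v' m) then v' m div 2 else N + v' m div 2)" for m
  have "g (w' m) = v' m" for m
  proof (cases "even (v' m)")
    case True
    then have "w' m < N" using N[of m] by (auto simp: w'_def)
    then show ?thesis using True by (simp add: g_def w'_def)
  next
    case False
    then show ?thesis by (simp add: g_def w'_def)
  qed
  then have v': "v' = g \<circ> w'" by auto
  have "inj g"
  proof (rule injI)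
    fix x y assume "g x = g y"
    then show "x = y" unfolding g_def by (auto split: if_splits; presburger)
  qed
  moreover have "(g x, g y) \<in> two_omega \<longleftrightarrow> (x, y) \<in> natLeq" for x y
    by (auto simp: g_def two_omega_def natLeq_def)
  ultimately have "bf (Suc 0) UNIV two_omega v' UNIV natLeq w'"
    unfolding v' by (rule bf_1_embedding)
  moreover have "\<forall>m. m \<notin> X \<longrightarrow> w' m = w m" using X(2) by (simp add: w'_def)
  ultimately show "\<exists>w'. (\<forall>m\<in>X. w' m \<in> UNIV) \<and> (\<forall>m. m \<notin> X \<longrightarrow> w' m = w m) \<and>
      bf (Suc 0) UNIV two_omega v' UNIV natLeq w'"
    by blast
qed

text \<open>A tuple of \<omega> is answered by the same tuple in the first copy, that is, by
  doubling.\<close>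

lemma bf_3_omega:
  "bf (Suc (Suc (Suc 0))) UNIV two_omega (\<lambda>_. 0) UNIV natLeq (\<lambda>_. 0)"
  unfolding bf.simps(2)[of "Suc (Suc 0)"]
proof (intro allI impI)
  fix X :: "nat set" and w' :: "nat \<Rightarrow> nat" assume X: "finite X" "\<forall>m. m \<notin> X \<longrightarrow> w' m = 0"
  have "range w' \<subseteq> w' ` X \<union> {0}" using X(2) by auto
  then have "finite (range w')" using X(1) finite_subset by blast
  then show "\<exists>v'. (\<forall>m\<in>X. v' m \<in> UNIV) \<and> (\<forall>m. m \<notin> X \<longrightarrow> v' m = 0) \<and>
      bf (Suc (Suc 0)) UNIV natLeq w' UNIV two_omega v'"
    using X(2) bf_2_omega by (intro exI[of _ "\<lambda>m. 2 * w' m"]) (simp del: bf.simps)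
qed

text \<open>Some non-minimal element has no immediate predecessor; true in \<open>\<omega> + \<omega>\<close>, false in \<open>\<omega>\<close>.\<close>

definition has_limit :: fm where
  "has_limit = Disj (\<lambda>_. exs [0, 1] (Conj (\<lambda>_. alls [2] (Disj (\<lambda>_. exs [3]
    (And (Lt 1 0) (Or (Neg (Lt 2 0)) (And (Lt 2 3) (Lt 3 0)))))))))"

lemma Sigma_in_has_limit: "Sigma_in (natLeq_on 3) has_limit"
  unfolding has_limit_def
proof (rule Sigma_step)
  let ?M = "And (Lt 1 0) (Or (Neg (Lt 2 0)) (And (Lt 2 3) (Lt 3 0)))"
  have "Pi_in {} ?M" by (intro Pi_0 qfree.intros) auto
  then have 1: "Sigma_in (natLeq_on 1) (Disj (\<lambda>_::nat. exs [3] ?M))"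
    using empty_ordLess_natLeq_on[of 1] by (intro Sigma_step) auto
  have 2: "Pi_in (natLeq_on 2) (Conj (\<lambda>_::nat. alls [2] (Disj (\<lambda>_::nat. exs [3] ?M))))"
    using 1 natLeq_on_ordLess[of 1 2] by (intro Pi_step exI[of _ "natLeq_on 1"]) auto
  show "\<exists>\<beta>. \<beta> <o natLeq_on 3 \<and> Pi_in \<beta> (Conj (\<lambda>_::nat. alls [2] (Disj (\<lambda>_::nat. exs [3] ?M))))"
    using 2 natLeq_on_ordLess[of 2 3] by (intro exI[of _ "natLeq_on 2"]) auto
qed

lemma sat_has_limit:
  "sat A R has_limit v \<longleftrightarrow> (\<exists>x\<in>A. \<exists>y\<in>A. \<forall>u\<in>A. (y, x) \<in> R \<and> y \<noteq> x \<and>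
    (\<exists>z\<in>A. (u, x) \<in> R \<longrightarrow> u = x \<or> (u, z) \<in> R \<and> u \<noteq> z \<and> (z, x) \<in> R \<and> z \<noteq> x))"
  by (simp add: has_limit_def exs_def alls_def Lt_def)

text \<open>Turns a \<open>\<Pi>\<^sub>3\<close> Scott sentence into a refutation of
  \<open>has_SSC\<close> at \<open>\<Sigma>\<^sub>3\<close>. The formula \<open>has_limit\<close>
  cannot be equivalent to a \<open>\<Pi>\<^sub>3\<close> formula, since \<open>bf_3_omega\<close>
  would carry it from \<omega> + \<omega> to \<omega>.\<close>

lemma not_Sigma_3_le_Pi_3: "\<not> cclass_le (SigmaIn (natLeq_on 3)) (PiIn (natLeq_on 3))"
proof
  assume le: "cclass_le (SigmaIn (natLeq_on 3)) (PiIn (natLeq_on 3))"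
  have "finite (fv has_limit)" by (simp add: has_limit_def)
  then have "has_limit \<in> cclass_formulas (SigmaIn (natLeq_on 3))"
    using Sigma_in_has_limit by simp
  then obtain \<psi> where \<psi>: "Pi_in (natLeq_on 3) \<psi>" and eq: "equivalent has_limit \<psi>"
    using le unfolding cclass_le_def by auto
  have eq': "sat UNIV S has_limit v \<longleftrightarrow> sat UNIV S \<psi> v" for S :: "nat rel" and v
    using eq unfolding equivalent_def countable_structure_def by auto
  have "sat UNIV two_omega has_limit (\<lambda>_. 0)"
    unfolding sat_has_limit
  proof (intro bexI ballI conjI)
    fix u :: nat
    \<comment> \<open>The limit point is 1, the first odd number, with 0 below it; the next even
      number \<open>u + 2\<close> lies between an even \<open>u\<close> and 1.\<close>
    show "(0, 1) \<in> two_omega" "(0::nat) \<noteq> 1" by (auto simp: two_omega_def)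
    show "(u, 1) \<in> two_omega \<longrightarrow> u = 1 \<or>
       (u, u + 2) \<in> two_omega \<and> u \<noteq> u + 2 \<and> (u + 2, 1) \<in> two_omega \<and> u + 2 \<noteq> 1"
      unfolding two_omega_def by simp presburger
  qed auto
  then have "sat UNIV two_omega \<psi> (\<lambda>_. 0)" using eq' by blast
  then have "sat UNIV natLeq \<psi> (\<lambda>_. 0)"
    using bf_transfer[OF bf_3_omega, of "natLeq_on 3" \<psi>] \<psi> by (simp add: Field_natLeq_on)
  then have "sat UNIV natLeq has_limit (\<lambda>_. 0)" using eq' by blast
  then obtain x y :: nat where
    *: "\<And>u. y \<le> x \<and> y \<noteq> x \<and> (\<exists>z. u \<le> x \<longrightarrow> u = x \<or> u \<le> z \<and> u \<noteq> z \<and> z \<le> x \<and> z \<noteq> x)"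
    unfolding sat_has_limit by (auto simp: natLeq_def)
  then have "y < x" by (metis le_neq_implies_less)
  \<comment> \<open>In \<omega> nothing fits between the predecessor \<open>x - 1\<close> and
    \<open>x\<close>.\<close>
  moreover obtain z where "x - 1 \<le> x \<longrightarrow> x - 1 = x \<or> x - 1 \<le> z \<and> x - 1 \<noteq> z \<and> z \<le> x \<and> z \<noteq> x"
    using * by blast
  ultimately show False by linarith
qed

section \<open>A sentence describing dense gaps\<close>

definition conjs :: "nat \<Rightarrow> fm list \<Rightarrow> fm" where
  "conjs u \<phi>s = foldr And \<phi>s (Eq u u)"

lemma sat_conjs: "sat A R (conjs u \<phi>s) v \<longleftrightarrow> (\<forall>\<phi>\<in>set \<phi>s. sat A R \<phi> v)"
  by (induction \<phi>s) (auto simp: conjs_def)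

lemma qfree_conjs: "(\<And>\<phi>. \<phi> \<in> set \<phi>s \<Longrightarrow> qfree \<phi>) \<Longrightarrow> qfree (conjs u \<phi>s)"
  by (induction \<phi>s) (simp_all add: conjs_def qfree.intros)

lemma fv_conjs: "fv (conjs u \<phi>s) = insert u (\<Union>\<phi>\<in>set \<phi>s. fv \<phi>)"
  by (induction \<phi>s) (auto simp: conjs_def)

definition gap_fm :: "nat list \<Rightarrow> nat set \<Rightarrow> nat \<Rightarrow> fm" where
  "gap_fm vs C t = conjs t (map (\<lambda>i. if i \<in> C then Lt i t else Lt t i) vs)"

text \<open>The formula speaks of a single point \<open>u\<close> avoiding all the listed gaps. One
  universal quantifier over \<open>u\<close> thus expresses that they are empty, and the negation
  costs one existential quantifier.\<close>

definition frame_fm :: "nat list \<Rightarrow> nat rel \<Rightarrow> nat set list \<Rightarrow> nat \<Rightarrow> fm" where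
  "frame_fm vs P Es u = conjs u
    (map (\<lambda>(i, j). if (i, j) \<in> P then Le i j else Neg (Le i j)) (List.product vs vs) @
     map (\<lambda>C. Neg (gap_fm vs C u)) Es)"

text \<open>The flags are resolved outside the formula, so each gap gives rise to four formulas;
  \<open>z\<close> is meant as the existential witness.\<close>

definition dense_fm :: "nat list \<Rightarrow> bool \<Rightarrow> bool \<Rightarrow> nat set \<Rightarrow> nat \<Rightarrow> nat \<Rightarrow> nat \<Rightarrow> fm" where
  "dense_fm vs p q C x y z =
    Or (Neg (conjs z ((if p then [gap_fm vs C x] else []) @ (if q then [gap_fm vs C y] else []) @
        (if p \<and> q then [Lt x y] else []))))
      (conjs z (gap_fm vs C z # (if p then [Lt x z] else []) @ (if q then [Lt z y] else [])))"

definition linord_fm :: "nat \<Rightarrow> nat \<Rightarrow> nat \<Rightarrow> fm" where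
  "linord_fm x y z = conjs x [Le x x, Or (Le x y) (Le y x),
    Or (Neg (And (Le x y) (Le y x))) (Eq x y), Or (Neg (And (Le x y) (Le y z))) (Le x z)]"

lemma sat_Lt: "sat A R (Lt m n) v \<longleftrightarrow> lt R (v m) (v n)"
  by (simp add: Lt_def lt_def)

lemma qfree_gap_fm: "qfree (gap_fm vs C t)"
  unfolding gap_fm_def by (rule qfree_conjs) auto

lemma qfree_frame_fm: "qfree (frame_fm vs P Es u)"
  unfolding frame_fm_def by (rule qfree_conjs) (auto simp: qfree_gap_fm qfree.intros)

lemma qfree_dense_fm: "qfree (dense_fm vs p q C x y z)"
  unfolding dense_fm_def
  by (rule qfree.intros, rule qfree.intros; rule qfree_conjs)
    (auto simp: qfree_gap_fm split: if_splits)

lemma qfree_linord_fm: "qfree (linord_fm x y z)"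
  unfolding linord_fm_def by (rule qfree_conjs) (auto simp: qfree.intros)

lemma fv_gap_fm: "fv (gap_fm vs C t) = insert t (set vs)"
  unfolding gap_fm_def fv_conjs by auto

lemma fv_frame_fm: "fv (frame_fm vs P Es u) \<subseteq> insert u (set vs)"
  unfolding frame_fm_def by (auto simp: fv_conjs fv_gap_fm split: if_splits)

lemma fv_dense_fm: "fv (dense_fm vs p q C x y z) \<subseteq> {x, y, z} \<union> set vs"
  unfolding dense_fm_def by (cases p; cases q; simp add: fv_conjs fv_gap_fm; blast)

lemma fv_linord_fm: "fv (linord_fm x y z) = {x, y, z}"
  unfolding linord_fm_def by (auto simp: fv_conjs)

lemma sat_gap_fm: "v t \<in> A \<Longrightarrow> sat A R (gap_fm vs C t) v \<longleftrightarrow> v t \<in> gap A R (set vs) v C"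
proof -
  assume "v t \<in> A"
  have "sat A R (if i \<in> C then Lt i t else Lt t i) v \<longleftrightarrow> (if i \<in> C then lt R (v i) (v t) else lt R (v t) (v i))" for i
    by (simp add: sat_Lt)
  then show ?thesis
    using \<open>v t \<in> A\<close> unfolding gap_fm_def sat_conjs gap_def set_map ball_simps by simp
qed

lemma sat_frame_fm:
  assumes "v u \<in> A"
  shows "sat A R (frame_fm vs P Es u) v \<longleftrightarrow>
    (\<forall>i\<in>set vs. \<forall>j\<in>set vs. (v i, v j) \<in> R \<longleftrightarrow> (i, j) \<in> P) \<and>
    (\<forall>C\<in>set Es. v u \<notin> gap A R (set vs) v C)"
proof -
  have "sat A R (if (i, j) \<in> P then Le i j else Neg (Le i j)) v \<longleftrightarrow> ((v i, v j) \<in> R \<longleftrightarrow> (i, j) \<in> P)" for i j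
    by simp
  then show ?thesis unfolding frame_fm_def sat_conjs
    using sat_gap_fm[where t = u and v = v, OF assms]
    by (simp add: ball_Un)
qed

lemma sat_dense_fm:
  assumes "v x \<in> A" "v y \<in> A" "v z \<in> A"
  shows "sat A R (dense_fm vs p q C x y z) v \<longleftrightarrow>
    ((p \<longrightarrow> v x \<in> gap A R (set vs) v C) \<and> (q \<longrightarrow> v y \<in> gap A R (set vs) v C) \<and>
      (p \<and> q \<longrightarrow> lt R (v x) (v y)) \<longrightarrow>
     v z \<in> gap A R (set vs) v C \<and> (p \<longrightarrow> lt R (v x) (v z)) \<and> (q \<longrightarrow> lt R (v z) (v y)))"
  unfolding dense_fm_def sat.simps sat_conjs
  using sat_gap_fm[where t = x and v = v, OF assms(1)] sat_gap_fm[where t = y and v = v, OF assms(2)]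
    sat_gap_fm[where t = z and v = v, OF assms(3)]
  by (cases p; cases q; simp add: sat_Lt; blast)

lemma sat_linord_fm:
  "sat A R (linord_fm x y z) v \<longleftrightarrow> (v x, v x) \<in> R \<and> ((v x, v y) \<in> R \<or> (v y, v x) \<in> R) \<and>
    ((v x, v y) \<in> R \<and> (v y, v x) \<in> R \<longrightarrow> v x = v y) \<and>
    ((v x, v y) \<in> R \<and> (v y, v z) \<in> R \<longrightarrow> (v x, v z) \<in> R)"
  unfolding linord_fm_def sat_conjs by simp blast

lemma sat_all_linord_fm:
  assumes "R \<subseteq> A \<times> A" "distinct [x, y, z]"
  shows "sat A R (alls [x, y, z] (linord_fm x y z)) v \<longleftrightarrow> linear_order_on A R"
proof -
  have "sat A R (alls [x, y, z] (linord_fm x y z)) v \<longleftrightarrow>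
    (\<forall>a\<in>A. \<forall>b\<in>A. \<forall>c\<in>A. (a, a) \<in> R \<and> ((a, b) \<in> R \<or> (b, a) \<in> R) \<and>
      ((a, b) \<in> R \<and> (b, a) \<in> R \<longrightarrow> a = b) \<and> ((a, b) \<in> R \<and> (b, c) \<in> R \<longrightarrow> (a, c) \<in> R))"
    using assms(2) by (simp add: alls_def sat_linord_fm)
  also have "\<dots> \<longleftrightarrow> linear_order_on A R"
  proof
    assume h: "\<forall>a\<in>A. \<forall>b\<in>A. \<forall>c\<in>A. (a, a) \<in> R \<and> ((a, b) \<in> R \<or> (b, a) \<in> R) \<and>
      ((a, b) \<in> R \<and> (b, a) \<in> R \<longrightarrow> a = b) \<and> ((a, b) \<in> R \<and> (b, c) \<in> R \<longrightarrow> (a, c) \<in> R)"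
    have "trans R"
    proof (rule transI)
      fix a b c assume "(a, b) \<in> R" "(b, c) \<in> R"
      moreover then have "a \<in> A" "b \<in> A" "c \<in> A" using assms(1) by auto
      ultimately show "(a, c) \<in> R" using h by blast
    qed
    moreover have "antisym R"
    proof (rule antisymI)
      fix a b assume "(a, b) \<in> R" "(b, a) \<in> R"
      moreover then have "a \<in> A" "b \<in> A" using assms(1) by auto
      ultimately show "a = b" using h by blast
    qed
    moreover have "refl_on A R" unfolding refl_on_def using h by blast
    moreover have "total_on A R" unfolding total_on_def using h by blast
    ultimately show "linear_order_on A R" using assms(1) by (simp add: order_on_defs)
  next
    assume "linear_order_on A R"
    then interpret linord A R by unfold_locales
    show "\<forall>a\<in>A. \<forall>b\<in>A. \<forall>c\<in>A. (a, a) \<in> R \<and> ((a, b) \<in> R \<or> (b, a) \<in> R) \<and>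
      ((a, b) \<in> R \<and> (b, a) \<in> R \<longrightarrow> a = b) \<and> ((a, b) \<in> R \<and> (b, c) \<in> R \<longrightarrow> (a, c) \<in> R)"
    proof (intro ballI conjI impI)
      fix a b c assume "a \<in> A" "b \<in> A"
      then show "(a, a) \<in> R" "(a, b) \<in> R \<or> (b, a) \<in> R"
        using R_refl lt_total[of a b] by (auto simp: lt_def)
    qed (auto intro: R_antisym R_trans)
  qed
  finally show ?thesis .
qed

lemma gap_cong_family: "(\<And>i. i \<in> I \<Longrightarrow> c i = d i) \<Longrightarrow> gap A R I c C = gap A R I d C"
  unfolding gap_def by auto

section \<open>Semantics of the frame and density formulas, and the resulting sentence\<close>

definition frame :: "nat set \<Rightarrow> nat rel \<Rightarrow> nat set set \<Rightarrow> 'a set \<Rightarrow> 'a rel \<Rightarrow> (nat \<Rightarrow> 'a) \<Rightarrow> bool" where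
  "frame I P E A R d \<longleftrightarrow> d ` I \<subseteq> A \<and> (\<forall>i\<in>I. \<forall>j\<in>I. (d i, d j) \<in> R \<longleftrightarrow> (i, j) \<in> P) \<and>
    (\<forall>C\<in>E. gap A R I d C = {})"

lemma sat_ex_frame:
  assumes u: "u \<notin> set vs" and v: "range v \<subseteq> A"
  shows "sat A R (Disj (\<lambda>_. exs vs (Conj (\<lambda>_. alls [u] (frame_fm vs P Es u))))) v \<longleftrightarrow>
    (\<exists>d. frame (set vs) P (set Es) A R d)"
proof
  assume "sat A R (Disj (\<lambda>_. exs vs (Conj (\<lambda>_. alls [u] (frame_fm vs P Es u))))) v"
  then obtain d where d: "\<forall>m\<in>set vs. d m \<in> A" "\<forall>m. m \<notin> set vs \<longrightarrow> d m = v m"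
    "sat A R (alls [u] (frame_fm vs P Es u)) d"
    unfolding sat.simps sat_exs by blast
  have sat: "sat A R (frame_fm vs P Es u) (d(u := a))" if "a \<in> A" for a
    using d(3) that by (simp add: alls_def)
  have gap: "gap A R (set vs) (d(u := a)) C = gap A R (set vs) d C" for a C
    using u by (intro gap_cong_family) auto
  have upd: "(d(u := a)) i = d i" if "i \<in> set vs" for a i using u that by auto
  have *: "(\<forall>i\<in>set vs. \<forall>j\<in>set vs. (d i, d j) \<in> R \<longleftrightarrow> (i, j) \<in> P) \<and>
      (\<forall>C\<in>set Es. a \<notin> gap A R (set vs) d C)" if "a \<in> A" for a
  proof -
    have "(d(u := a)) u \<in> A" using that by simp
    from sat[OF that] show ?thesis
      unfolding sat_frame_fm[where v = "d(u := a)" and u = u, OF \<open>(d(u := a)) u \<in> A\<close>] gap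
      using upd by simp
  qed
  \<comment> \<open>The order part of \<open>*\<close> does not mention \<open>a\<close>, but a
    point of \<open>A\<close> is required to extract it.\<close>
  have "v 0 \<in> A" using v by auto
  then have "frame (set vs) P (set Es) A R d"
    unfolding frame_def using d(1) * gap_subset[of A R "set vs" d] by fast
  then show "\<exists>d. frame (set vs) P (set Es) A R d" by blast
next
  assume "\<exists>d. frame (set vs) P (set Es) A R d"
  then obtain d where d: "frame (set vs) P (set Es) A R d" by blast
  define d' where "d' m = (if m \<in> set vs then d m else v m)" for m
  have gap: "gap A R (set vs) (d'(u := a)) C = gap A R (set vs) d C" for a C
    using u by (intro gap_cong_family) (auto simp: d'_def)
  have upd: "(d'(u := a)) i = d i" if "i \<in> set vs" for a i using u that by (auto simp: d'_def)
  have "sat A R (frame_fm vs P Es u) (d'(u := a))" if "a \<in> A" for a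
  proof -
    have "(d'(u := a)) u \<in> A" using that by simp
    then show ?thesis
      unfolding sat_frame_fm[where v = "d'(u := a)" and u = u, OF \<open>(d'(u := a)) u \<in> A\<close>] gap
      using d upd unfolding frame_def by simp
  qed
  then have "sat A R (alls [u] (frame_fm vs P Es u)) d'" by (simp add: alls_def)
  moreover have "\<forall>m\<in>set vs. d' m \<in> A" "\<forall>m. m \<notin> set vs \<longrightarrow> d' m = v m"
    using d by (auto simp: d'_def frame_def)
  ultimately show "sat A R (Disj (\<lambda>_. exs vs (Conj (\<lambda>_. alls [u] (frame_fm vs P Es u))))) v"
    unfolding sat.simps sat_exs by blast
qed

text \<open>The existential \<open>u\<close> disposes of families that are not frames: either a
  comparison is wrong, and any \<open>u\<close> will do, or \<open>u\<close> is a point in a gap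
  that should be empty. This puts "every frame has a dense gap at \<open>C\<close>" into the form of
  universal quantifiers followed by existential ones.\<close>

lemma sat_all_dense:
  assumes dist: "distinct [u, x, y, z]" "{u, x, y, z} \<inter> set vs = {}" and v: "range v \<subseteq> A"
  shows "(\<forall>p q. sat A R (alls (vs @ [x, y]) (Disj (\<lambda>_. exs [u, z]
      (Or (Neg (frame_fm vs P Es u)) (dense_fm vs p q C x y z))))) v) \<longleftrightarrow>
    (\<forall>d. frame (set vs) P (set Es) A R d \<longrightarrow> dense_set R (gap A R (set vs) d C))" (is "?l = ?r")
proof
  assume l: ?l
  show ?r
  proof (intro allI impI)
    fix d assume d: "frame (set vs) P (set Es) A R d"
    show "dense_set R (gap A R (set vs) d C)"
      unfolding dense_set_def
    proof (intro allI impI)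
      fix p q x0 y0
      assume h: "p \<longrightarrow> x0 \<in> gap A R (set vs) d C" "q \<longrightarrow> y0 \<in> gap A R (set vs) d C"
        "p \<and> q \<longrightarrow> lt R x0 y0"
      \<comment> \<open>With its flag off, \<open>x0\<close> may lie outside \<open>A\<close>, while
        the variable \<open>x\<close> ranges over \<open>A\<close>; \<open>v 0\<close> is a
        filler.\<close>
      define x1 where "x1 = (if p then x0 else v 0)"
      define y1 where "y1 = (if q then y0 else v 0)"
      have xy1: "x1 \<in> A" "y1 \<in> A" 
        using h(1,2) v gap_subset[of A R "set vs" d C] unfolding x1_def y1_def by auto
      define d' where "d' m = (if m \<in> set vs then d m else if m = x then x1 else if m = y then y1 else v m)" for m
      have d': "\<forall>m\<in>set (vs @ [x, y]). d' m \<in> A" "\<forall>m. m \<notin> set (vs @ [x, y]) \<longrightarrow> d' m = v m"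
        using d xy1 unfolding d'_def frame_def by auto
      have "sat A R (Disj (\<lambda>_. exs [u, z] (Or (Neg (frame_fm vs P Es u)) (dense_fm vs p q C x y z)))) d'"
        using l d' unfolding sat_alls by blast
      then obtain w where w: "w u \<in> A" "w z \<in> A" "\<And>m. m \<noteq> u \<Longrightarrow> m \<noteq> z \<Longrightarrow> w m = d' m"
        and sat: "sat A R (frame_fm vs P Es u) w \<longrightarrow> sat A R (dense_fm vs p q C x y z) w"
        unfolding sat.simps sat_exs by auto
      have wd: "w i = d i" if "i \<in> set vs" for i using w(3)[of i] that dist by (auto simp: d'_def)
      have gap: "gap A R (set vs) w D = gap A R (set vs) d D" for D
        using wd by (rule gap_cong_family)
      have wxy: "w x = x1" "w y = y1" using w(3)[of x] w(3)[of y] dist by (auto simp: d'_def)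
      have wA: "w x \<in> A" "w y \<in> A" using wxy xy1 by auto
      have "sat A R (frame_fm vs P Es u) w"
        using d by (subst sat_frame_fm[where u = u and v = w, OF w(1)]) (auto simp: gap wd frame_def)
      then have "sat A R (dense_fm vs p q C x y z) w" using sat by blast
      then have "(p \<longrightarrow> x1 \<in> gap A R (set vs) d C) \<and> (q \<longrightarrow> y1 \<in> gap A R (set vs) d C) \<and>
        (p \<and> q \<longrightarrow> lt R x1 y1) \<longrightarrow>
        w z \<in> gap A R (set vs) d C \<and> (p \<longrightarrow> lt R x1 (w z)) \<and> (q \<longrightarrow> lt R (w z) y1)"
        unfolding sat_dense_fm[where v = w and x = x and y = y and z = z, OF wA w(2)] gap wxy .
      then show "\<exists>z\<in>gap A R (set vs) d C. (p \<longrightarrow> lt R x0 z) \<and> (q \<longrightarrow> lt R z y0)"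
        using h unfolding x1_def y1_def by (intro bexI[of _ "w z"]) auto
    qed
  qed
next
  assume r: ?r
  show ?l
  proof (intro allI)
    fix p q
    show "sat A R (alls (vs @ [x, y]) (Disj (\<lambda>_. exs [u, z]
      (Or (Neg (frame_fm vs P Es u)) (dense_fm vs p q C x y z))))) v"
      unfolding sat_alls
    proof (intro allI impI)
      fix d assume "\<forall>m\<in>set (vs @ [x, y]). d m \<in> A"
      then have dA: "\<forall>m\<in>set vs. d m \<in> A" "d x \<in> A" "d y \<in> A" by auto
      have v0: "v 0 \<in> A" using v by auto
      define w where "w u0 z0 = d(u := u0, z := z0)" for u0 z0
      have wd: "w u0 z0 i = d i" if "i \<in> set vs" for i u0 z0 using that dist by (auto simp: w_def)
      have gap: "gap A R (set vs) (w u0 z0) D = gap A R (set vs) d D" for D u0 z0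
        using wd by (rule gap_cong_family)
      have ws: "w u0 z0 x = d x" "w u0 z0 y = d y" "w u0 z0 z = z0" "w u0 z0 u = u0" for u0 z0
        using dist by (auto simp: w_def)
      have "\<exists>u0\<in>A. \<exists>z0\<in>A. sat A R (frame_fm vs P Es u) (w u0 z0) \<longrightarrow>
          sat A R (dense_fm vs p q C x y z) (w u0 z0)"
      proof (cases "frame (set vs) P (set Es) A R d")
        case True
        then have dense: "dense_set R (gap A R (set vs) d C)" using r by blast
        obtain z0 where z0: "z0 \<in> A" "(p \<longrightarrow> d x \<in> gap A R (set vs) d C) \<and>
          (q \<longrightarrow> d y \<in> gap A R (set vs) d C) \<and> (p \<and> q \<longrightarrow> lt R (d x) (d y)) \<longrightarrow>
          z0 \<in> gap A R (set vs) d C \<and> (p \<longrightarrow> lt R (d x) z0) \<and> (q \<longrightarrow> lt R z0 (d y))"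
        proof (cases "(p \<longrightarrow> d x \<in> gap A R (set vs) d C) \<and>
            (q \<longrightarrow> d y \<in> gap A R (set vs) d C) \<and> (p \<and> q \<longrightarrow> lt R (d x) (d y))")
          case True
          then have "\<exists>z\<in>gap A R (set vs) d C. (p \<longrightarrow> lt R (d x) z) \<and> (q \<longrightarrow> lt R z (d y))"
            by (intro dense_setD[OF dense]) auto
          then show ?thesis using that gap_subset[of A R "set vs" d C] by auto
        next
          case False
          then show ?thesis using that[OF v0] by argo
        qed
        have "sat A R (dense_fm vs p q C x y z) (w (v 0) z0)"
          using z0 dA by (subst sat_dense_fm) (simp_all only: ws gap)
        then show ?thesis using v0 z0(1) by blast
      next
        case False
        then consider "\<not> (\<forall>i\<in>set vs. \<forall>j\<in>set vs. (d i, d j) \<in> R \<longleftrightarrow> (i, j) \<in> P)" |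
          D u0 where "D \<in> set Es" "u0 \<in> gap A R (set vs) d D"
          using dA(1) unfolding frame_def by blast
        then show ?thesis
        proof cases
          case 1
          have "\<not> sat A R (frame_fm vs P Es u) (w (v 0) (v 0))"
            using 1 v0 by (subst sat_frame_fm) (auto simp: ws wd)
          then show ?thesis using v0 by blast
        next
          case 2
          then have "u0 \<in> A" using gap_subset[of A R "set vs" d D] by blast
          then have "\<not> sat A R (frame_fm vs P Es u) (w u0 (v 0))"
            using 2 by (subst sat_frame_fm) (auto simp: ws gap)
          then show ?thesis using v0 \<open>u0 \<in> A\<close> by blast
        qed
      qed
      then obtain u0 z0 where uz: "u0 \<in> A" "z0 \<in> A" and
        sat: "sat A R (Or (Neg (frame_fm vs P Es u)) (dense_fm vs p q C x y z)) (w u0 z0)" by auto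
      have "sat A R (exs [u, z] (Or (Neg (frame_fm vs P Es u)) (dense_fm vs p q C x y z))) d"
        unfolding exs_def foldr.simps o_apply id_apply sat.simps(8)
        using uz(1)
      proof (rule bexI[rotated])
        show "\<exists>z0\<in>A. sat A R (Or (Neg (frame_fm vs P Es u)) (dense_fm vs p q C x y z)) (d(u := u0, z := z0))"
          using uz(2) sat unfolding w_def by (rule bexI[rotated])
      qed
      then show "sat A R (Disj (\<lambda>_. exs [u, z] (Or (Neg (frame_fm vs P Es u)) (dense_fm vs p q C x y z)))) d"
        by simp
    qed
  qed
qed

text \<open>Below their outer universal blocks the conjuncts have level 0 (order axioms), 2
  (existence of a frame, with an empty block) and 1 (density), all smaller than 3.\<close>

lemma ex_frame_sentence:
  assumes "finite I" "finite E" "finite K"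
  shows "\<exists>\<Theta>. Pi_in (natLeq_on 3) \<Theta> \<and> fv \<Theta> = {} \<and>
    (\<forall>(B :: nat set) S. countable_structure B S \<longrightarrow> (models B S \<Theta> \<longleftrightarrow>
      linear_order_on B S \<and> (\<exists>d. frame I P E B S d) \<and>
      (\<forall>C\<in>K. \<forall>d. frame I P E B S d \<longrightarrow> dense_set S (gap B S I d C))))"
proof -
  obtain vs where vs: "set vs = I" using finite_list[OF assms(1)] by blast
  obtain Es where Es: "set Es = E" using finite_list[OF assms(2)] by blast
  obtain N where "\<forall>i\<in>I. i < N" using assms(1) finite_nat_set_iff_bounded by blast
  then have I: "i < N" if "i \<in> I" for i using that by blast
  define u x y z where "u = N" "x = N + 1" "y = N + 2" "z = N + 3"
  note uxyz = this
  have dist: "distinct [u, x, y, z]" by (simp add: uxyz)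
  have disj: "{u, x, y, z} \<inter> set vs = {}" using I unfolding vs uxyz by fastforce
  define t1 where "t1 = ([x, y, z], linord_fm x y z)"
  define t2 where "t2 = ([] :: nat list, Disj (\<lambda>_. exs vs (Conj (\<lambda>_. alls [u] (frame_fm vs P Es u)))))"
  define t3 where "t3 p q C = (vs @ [x, y], Disj (\<lambda>_. exs [u, z]
    (Or (Neg (frame_fm vs P Es u)) (dense_fm vs p q C x y z))))" for p q C
  define T where "T = {t1, t2} \<union> (\<Union>C\<in>K. {t3 True True C, t3 True False C, t3 False True C, t3 False False C})"
  have T_cases: "(\<forall>t\<in>T. Q t) \<longleftrightarrow> Q t1 \<and> Q t2 \<and> (\<forall>C\<in>K. \<forall>p q. Q (t3 p q C))" for Q
  proof -
    have "(\<forall>p q. Q (t3 p q C)) \<longleftrightarrow>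
      Q (t3 True True C) \<and> Q (t3 True False C) \<and> Q (t3 False True C) \<and> Q (t3 False False C)" for C
      by (metis (full_types))
    then show ?thesis by (simp add: T_def ball_Un)
  qed
  \<comment> \<open>\<open>Conj\<close> is indexed by all of \<open>nat\<close>, so the finite set
    \<open>T\<close> is enumerated with repetitions.\<close>
  have "countable T" "T \<noteq> {}" unfolding T_def using assms(3) by (auto intro: countable_finite)
  then have range: "range (from_nat_into T) = T" by (simp add: range_from_nat_into)
  define \<Theta> where "\<Theta> = Conj (\<lambda>n. alls (fst (from_nat_into T n)) (snd (from_nat_into T n)))"
  have one: "Sigma_in (natLeq_on 1) (Disj (\<lambda>_. exs xs \<phi>))" if "qfree \<phi>" for xs \<phi>
    using empty_ordLess_natLeq_on[of 1] Pi_0[OF that] by (intro Sigma_step) auto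
  have lvl: "\<forall>t\<in>T. \<exists>\<beta>. \<beta> <o natLeq_on 3 \<and> Sigma_in \<beta> (snd t)"
    unfolding T_cases
  proof (intro conjI ballI allI)
    show "\<exists>\<beta>. \<beta> <o natLeq_on 3 \<and> Sigma_in \<beta> (snd t1)"
      using empty_ordLess_natLeq_on[of 3] Sigma_0[OF qfree_linord_fm] by (auto simp: t1_def)
    have "Pi_in (natLeq_on 1) (Conj (\<lambda>_. alls [u] (frame_fm vs P Es u)))"
      using empty_ordLess_natLeq_on[of 1] Sigma_0[OF qfree_frame_fm] by (intro Pi_step) auto
    then have "Sigma_in (natLeq_on 2) (snd t2)"
      using natLeq_on_ordLess[of 1 2] unfolding t2_def snd_conv
      by (intro Sigma_step exI[of _ "natLeq_on 1"]) auto
    then show "\<exists>\<beta>. \<beta> <o natLeq_on 3 \<and> Sigma_in \<beta> (snd t2)"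
      using natLeq_on_ordLess[of 2 3] by (intro exI[of _ "natLeq_on 2"]) auto
    fix C p q
    have "Sigma_in (natLeq_on 1) (snd (t3 p q C))"
      unfolding t3_def snd_conv
      by (intro one qfree.intros qfree_frame_fm qfree_dense_fm)
    then show "\<exists>\<beta>. \<beta> <o natLeq_on 3 \<and> Sigma_in \<beta> (snd (t3 p q C))"
      using natLeq_on_ordLess[of 1 3] by (intro exI[of _ "natLeq_on 1"]) auto
  qed
  have "Pi_in (natLeq_on 3) \<Theta>"
    unfolding \<Theta>_def
  proof (rule Pi_step)
    fix n
    have "from_nat_into T n \<in> T" using range by blast
    then show "\<exists>\<beta>. \<beta> <o natLeq_on 3 \<and> Sigma_in \<beta> (snd (from_nat_into T n))" using lvl by blast
  qed
  moreover have fv: "fv \<Theta> = {}"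
  proof -
    have "\<forall>t\<in>T. fv (snd t) \<subseteq> set (fst t)"
      unfolding T_cases
    proof (intro conjI ballI allI)
      show "fv (snd t1) \<subseteq> set (fst t1)" by (simp add: t1_def fv_linord_fm)
      show "fv (snd t2) \<subseteq> set (fst t2)" using fv_frame_fm[of vs P Es u] by (auto simp: t2_def)
      show "fv (snd (t3 p q C)) \<subseteq> set (fst (t3 p q C))" for C p q
        using fv_frame_fm[of vs P Es u] fv_dense_fm[of vs p q C x y z] by (auto simp: t3_def)
    qed
    moreover have "from_nat_into T n \<in> T" for n using range by blast
    ultimately show ?thesis unfolding \<Theta>_def by auto
  qed
  moreover have "models B S \<Theta> \<longleftrightarrow>
      linear_order_on B S \<and> (\<exists>d. frame I P E B S d) \<and>
      (\<forall>C\<in>K. \<forall>d. frame I P E B S d \<longrightarrow> dense_set S (gap B S I d C))"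
    if cs: "countable_structure B S" for B :: "nat set" and S
  proof -
    obtain b where b: "b \<in> B" and S: "S \<subseteq> B \<times> B" using cs unfolding countable_structure_def by blast
    then have rb: "range (\<lambda>_::nat. b) \<subseteq> B" by auto
    have "models B S \<Theta> \<longleftrightarrow> sat B S \<Theta> (\<lambda>_. b)" using models_sentence_iff[OF fv rb] .
    also have "\<dots> \<longleftrightarrow> (\<forall>t\<in>range (from_nat_into T). sat B S (alls (fst t) (snd t)) (\<lambda>_. b))"
      unfolding \<Theta>_def by simp
    also have "\<dots> \<longleftrightarrow> sat B S (alls (fst t1) (snd t1)) (\<lambda>_. b) \<and> sat B S (alls (fst t2) (snd t2)) (\<lambda>_. b) \<and>
        (\<forall>C\<in>K. \<forall>p q. sat B S (alls (fst (t3 p q C)) (snd (t3 p q C))) (\<lambda>_. b))"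
      unfolding range T_cases ..
    also have "\<dots> \<longleftrightarrow> linear_order_on B S \<and> (\<exists>d. frame I P E B S d) \<and>
      (\<forall>C\<in>K. \<forall>d. frame I P E B S d \<longrightarrow> dense_set S (gap B S I d C))"
    proof -
      have "sat B S (alls (fst t1) (snd t1)) (\<lambda>_. b) \<longleftrightarrow> linear_order_on B S"
        unfolding t1_def fst_conv snd_conv using S dist by (intro sat_all_linord_fm) auto
      moreover have "sat B S (alls (fst t2) (snd t2)) (\<lambda>_. b) \<longleftrightarrow> (\<exists>d. frame I P E B S d)"
        using sat_ex_frame[OF _ rb, of u vs S P Es] disj unfolding t2_def fst_conv snd_conv vs Es
        by (simp add: alls_def)
      moreover have "(\<forall>p q. sat B S (alls (fst (t3 p q C)) (snd (t3 p q C))) (\<lambda>_. b)) \<longleftrightarrow>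
          (\<forall>d. frame I P E B S d \<longrightarrow> dense_set S (gap B S I d C))" for C
        using sat_all_dense[OF dist disj rb, of S P Es C] unfolding t3_def fst_conv snd_conv vs Es .
      ultimately show ?thesis by (simp only:)
    qed
    finally show ?thesis .
  qed
  ultimately show ?thesis by blast
qed

section \<open>Minimal families with dense gaps\<close>

context linord
begin

lemma gap_convex:
  assumes "x \<in> gap A R I a C" "y \<in> gap A R I a C" "lt R x w" "lt R w y"
  shows "w \<in> gap A R I a C"
proof -
  have "if i \<in> C then lt R (a i) w else lt R w (a i)" if "i \<in> I" for i
  proof (cases "i \<in> C")
    case True
    then have "lt R (a i) x" using assms(1) that by (auto simp: gap_def)
    then show ?thesis using True assms(3) lt_trans by auto
  next
    case False
    then have "lt R y (a i)" using assms(2) that by (auto simp: gap_def)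
    then show ?thesis using False assms(4) lt_trans by auto
  qed
  then show ?thesis using lt_in[OF assms(3)] unfolding gap_def by auto
qed

text \<open>Serves to squeeze a point between an entry of a family and all smaller entries in the
  same dense set.\<close>

lemma dense_set_above_finite:
  assumes d: "dense_set R X" and y: "y \<in> X" and "finite L" "L \<subseteq> X" "\<forall>l\<in>L. lt R l y" and X: "X \<subseteq> A"
  shows "\<exists>z\<in>X. lt R z y \<and> (\<forall>l\<in>L. lt R l z)"
  using assms(3-5)
proof (induction L rule: finite_induct)
  case empty
  then show ?case using dense_setD[OF d, of False _ True y] y by auto
next
  case (insert l L)
  then obtain z where z: "z \<in> X" "lt R z y" "\<forall>l\<in>L. lt R l z" by auto
  define m where "m = (if lt R z l then l else z)"
  have m: "m \<in> X" "lt R m y" using z insert.prems by (auto simp: m_def)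
  then obtain z' where z': "z' \<in> X" "lt R m z'" "lt R z' y"
    using dense_setD[OF d, of True m True y] y by auto
  have "l = z \<or> lt R l z \<or> lt R z l" using lt_total z(1) insert.prems(1) X by blast
  then have "lt R l z'" using z'(2) lt_trans[of l z z'] by (auto simp: m_def split: if_splits)
  moreover have "lt R z z'" using z'(2) lt_trans[of z l z'] by (auto simp: m_def split: if_splits)
  then have "\<forall>l\<in>L. lt R l z'" using z(3) lt_trans by blast
  ultimately show ?case using z' by auto
qed

lemma dense_set_below_finite:
  assumes d: "dense_set R X" and y: "y \<in> X" and "finite L" "L \<subseteq> X" "\<forall>l\<in>L. lt R y l" and X: "X \<subseteq> A"
  shows "\<exists>z\<in>X. lt R y z \<and> (\<forall>l\<in>L. lt R z l)"
  using assms(3-5)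
proof (induction L rule: finite_induct)
  case empty
  then show ?case using dense_setD[OF d, of True y False] y by auto
next
  case (insert l L)
  then obtain z where z: "z \<in> X" "lt R y z" "\<forall>l\<in>L. lt R z l" by auto
  define m where "m = (if lt R l z then l else z)"
  have m: "m \<in> X" "lt R y m" using z insert.prems by (auto simp: m_def)
  then obtain z' where z': "z' \<in> X" "lt R y z'" "lt R z' m"
    using dense_setD[OF d, of True y True m] y by auto
  have "l = z \<or> lt R l z \<or> lt R z l" using lt_total z(1) insert.prems(1) X by blast
  then have "lt R z' l" using z'(3) lt_trans[of z' z l] by (auto simp: m_def split: if_splits)
  moreover have "lt R z' z" using z'(3) lt_trans[of z' l z] by (auto simp: m_def split: if_splits)
  then have "\<forall>l\<in>L. lt R z' l" using z(3) lt_trans by blast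
  ultimately show ?case using z' by auto
qed

section \<open>Tame families and the rigidity of minimal ones\<close>

definition tame :: "nat set \<Rightarrow> (nat \<Rightarrow> 'a) \<Rightarrow> bool" where
  "tame I c \<longleftrightarrow> finite I \<and> c ` I \<subseteq> A \<and> (\<forall>C. gap A R I c C = {} \<or> dense_set R (gap A R I c C))"

text \<open>A request in \<open>X\<close> can be answered strictly inside one of the two halves.
  Consequently an entry with dense gaps on both sides may be dropped from a family.\<close>

lemma dense_set_join:
  assumes X: "X \<subseteq> A" and h: "h \<in> X" and l: "dense_set R (lower R X h)" and u: "dense_set R (upper R X h)"
  shows "dense_set R X"
  unfolding dense_set_def
proof (intro allI impI)
  fix p q x y
  assume hyp: "p \<longrightarrow> x \<in> X" "q \<longrightarrow> y \<in> X" "p \<and> q \<longrightarrow> lt R x y"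
  have low: "\<exists>z\<in>X. lt R z h \<and> (p \<longrightarrow> lt R x z) \<and> (q \<longrightarrow> y \<in> lower R X h \<longrightarrow> lt R z y)"
    if "p \<longrightarrow> x \<in> lower R X h"
    using dense_setD[OF l, of p x "q \<and> y \<in> lower R X h" y] that hyp by (auto simp: lower_def)
  have upp: "\<exists>z\<in>X. lt R h z \<and> (q \<longrightarrow> lt R z y) \<and> (p \<longrightarrow> x \<in> upper R X h \<longrightarrow> lt R x z)"
    if "q \<longrightarrow> y \<in> upper R X h"
    using dense_setD[OF u, of "p \<and> x \<in> upper R X h" x q y] that hyp by (auto simp: upper_def)
  have tri: "w = h \<or> w \<in> lower R X h \<or> w \<in> upper R X h" if "w \<in> X" for w
    using lt_total[of w h] that X h by (auto simp: lower_def upper_def)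
  show "\<exists>z\<in>X. (p \<longrightarrow> lt R x z) \<and> (q \<longrightarrow> lt R z y)"
  proof (cases "p \<longrightarrow> x \<in> lower R X h")
    case True
    then obtain z where z: "z \<in> X" "lt R z h" "p \<longrightarrow> lt R x z" "q \<longrightarrow> y \<in> lower R X h \<longrightarrow> lt R z y"
      using low by blast
    have "lt R z y" if q
      using tri[of y] z(2,4) hyp(2) that lt_trans[of z h y] by (auto simp: upper_def)
    then show ?thesis using z by blast
  next
    case False
    then have px: p "x = h \<or> x \<in> upper R X h" using tri[of x] hyp(1) by auto
    have "y \<in> upper R X h" if q
      using px hyp(2,3) that lt_trans[of h x y] by (auto simp: upper_def)
    then obtain z where z: "z \<in> X" "lt R h z" "q \<longrightarrow> lt R z y" "x \<in> upper R X h \<longrightarrow> lt R x z"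
      using upp px(1) by blast
    then show ?thesis using px(2) by blast
  qed
qed

text \<open>Deleting an entry from a minimal family must spoil some gap. An entry outside that
  convex gap would not divide it, so the gap would have been fine already; an entry inside it with
  two dense halves could be dropped by \<open>dense_set_join\<close>. Hence one half is
  empty.\<close>

lemma minimal_tame_gap:
  assumes t: "tame I c" and min: "\<forall>J d. tame J d \<longrightarrow> card I \<le> card J" and i: "i \<in> I"
  shows "\<exists>C. c i \<in> gap A R (I - {i}) c C \<and>
    (gap A R I c (C - {i}) = {} \<or> gap A R I c (insert i C) = {})"
proof -
  let ?J = "I - {i}"
  have fin: "finite I" and cI: "c ` I \<subseteq> A" using t by (auto simp: tame_def)
  have "card ?J < card I" using card_Diff1_less[OF fin i] .
  then have "\<not> tame ?J c" using min by (meson not_le)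
  then obtain C where C: "gap A R ?J c C \<noteq> {}" "\<not> dense_set R (gap A R ?J c C)"
    using fin cI unfolding tame_def by auto
  let ?G = "gap A R ?J c C"
  have ins: "insert i ?J = I" "c(i := c i) = c" using i by auto
  have low: "gap A R I c (C - {i}) = lower R ?G (c i)"
  proof -
    have "gap A R ?J c (C - {i}) = ?G" by (rule gap_cong) auto
    then show ?thesis using gap_insert[of i ?J A R c "c i" "C - {i}"] unfolding ins by simp
  qed
  have upp: "gap A R I c (insert i C) = upper R ?G (c i)"
  proof -
    have "gap A R ?J c (insert i C) = ?G" by (rule gap_cong) auto
    then show ?thesis using gap_insert[of i ?J A R c "c i" "insert i C"] unfolding ins by simp
  qed
  have GA: "?G \<subseteq> A" by (rule gap_subset)
  have ciA: "c i \<in> A" using cI i by auto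
  have dl: "lower R ?G (c i) = {} \<or> dense_set R (lower R ?G (c i))"
    using t unfolding tame_def low[symmetric] by blast
  have du: "upper R ?G (c i) = {} \<or> dense_set R (upper R ?G (c i))"
    using t unfolding tame_def upp[symmetric] by blast
  have "c i \<in> ?G"
  proof (rule ccontr)
    assume n: "c i \<notin> ?G"
    have split: "?G = lower R ?G (c i) \<union> upper R ?G (c i)"
      using lt_total ciA GA n unfolding lower_def upper_def by blast
    have "lower R ?G (c i) = {} \<or> upper R ?G (c i) = {}"
      using n gap_convex[of _ ?J c C _ "c i"] unfolding lower_def upper_def by blast
    then have "?G = lower R ?G (c i) \<or> ?G = upper R ?G (c i)" using split by blast
    then show False using dl du C by metis
  qed
  moreover have "lower R ?G (c i) = {} \<or> upper R ?G (c i) = {}"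
    using dense_set_join[OF GA \<open>c i \<in> ?G\<close>] dl du C(2) by blast
  ultimately show ?thesis unfolding low[symmetric] upp[symmetric] by blast
qed

text \<open>Each \<open>c j\<close> borders an empty gap, and by \<open>E\<close> so does
  \<open>d j\<close>. If \<open>d j\<close> lay inside a dense gap \<open>X\<close> of
  \<open>c\<close>, then \<open>X\<close> would supply a point in the gap next to
  \<open>d j\<close>. So \<open>d\<close> only permutes the entries of \<open>c\<close>, and an
  order-preserving permutation of a finite linear order is the identity.\<close>

lemma minimal_tame_unique:
  assumes t: "tame I c" and min: "\<forall>J d. tame J d \<longrightarrow> card I \<le> card J"
    and dA: "d ` I \<subseteq> A" and ord: "\<And>i j. i \<in> I \<Longrightarrow> j \<in> I \<Longrightarrow> (d i, d j) \<in> R \<longleftrightarrow> (c i, c j) \<in> R"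
    and E: "\<And>C. gap A R I c C = {} \<Longrightarrow> gap A R I d C = {}"
    and i: "i \<in> I"
  shows "d i = c i"
proof -
  have fin: "finite I" and cA: "c ` I \<subseteq> A" using t by (auto simp: tame_def)
  have cdA: "c j \<in> A" "d j \<in> A" if "j \<in> I" for j using that cA dA by auto
  have lt_cd: "lt R (c j) (c k) \<longleftrightarrow> lt R (d j) (d k)" if "j \<in> I" "k \<in> I" for j k
    using ord[of k j] R_iff that cdA by (metis (full_types))
  have dc: "d j \<in> c ` I" if j: "j \<in> I" for j
  proof (rule ccontr)
    assume n: "d j \<notin> c ` I"
    define X where "X = gap A R I c {k. lt R (c k) (d j)}"
    have jX: "d j \<in> X" unfolding X_def by (rule in_own_gap[OF cdA(2)[OF j] cA n])
    then have dense: "dense_set R X" using t unfolding tame_def X_def by blast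
    have XA: "X \<subseteq> A" unfolding X_def by (rule gap_subset)
    have conv: "w \<in> X" if "x \<in> X" "y \<in> X" "lt R x w" "lt R w y" for x y w
      using gap_convex that unfolding X_def by blast
    obtain C where C: "c j \<in> gap A R (I - {j}) c C"
      "gap A R I c (C - {j}) = {} \<or> gap A R I c (insert j C) = {}"
      using minimal_tame_gap[OF t min j] by blast
    have Cd: "if k \<in> C then lt R (d k) (d j) else lt R (d j) (d k)" if "k \<in> I" "k \<noteq> j" for k
      using C(1) lt_cd[OF that(1) j] lt_cd[OF j that(1)] that unfolding gap_def by auto
    have gapI: "z \<in> gap A R I d D" if "z \<in> A"
      "\<And>k. k \<in> I \<Longrightarrow> if k \<in> D then lt R (d k) z else lt R z (d k)" for z D
      using that unfolding gap_def by blast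
    from C(2) show False
    proof
      assume "gap A R I c (C - {j}) = {}"
      then have e: "gap A R I d (C - {j}) = {}" by (rule E)
      let ?L = "{l\<in>d ` I \<inter> X. lt R l (d j)}"
      have "\<exists>z\<in>X. lt R z (d j) \<and> (\<forall>l\<in>?L. lt R l z)"
        using fin XA by (intro dense_set_above_finite[OF dense jX]) auto
      then obtain z where z: "z \<in> X" "lt R z (d j)" "\<forall>l\<in>?L. lt R l z" by blast
      \<comment> \<open>Entries below \<open>d j\<close> in \<open>X\<close> are covered by the
        choice of \<open>z\<close>; those outside the convex set \<open>X\<close> lie below all of
        it.\<close>
      have "lt R (d k) z" if k: "k \<in> I" "lt R (d k) (d j)" for k
      proof (cases "d k \<in> X")
        case False
        then show ?thesis using conv[OF z(1) jX _ k(2)] lt_total[of "d k" z] cdA(2)[OF k(1)] z(1) XA by blast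
      qed (use z(3) k in blast)
      then have "if k \<in> C - {j} then lt R (d k) z else lt R z (d k)" if "k \<in> I" for k
        using Cd[OF that] that z(2) lt_trans[OF z(2), of "d k"] by (cases "k = j"; cases "k \<in> C") auto
      then have "z \<in> gap A R I d (C - {j})" using z(1) XA by (intro gapI) auto
      then show False using e by blast
    next
      assume "gap A R I c (insert j C) = {}"
      then have e: "gap A R I d (insert j C) = {}" by (rule E)
      let ?L = "{l\<in>d ` I \<inter> X. lt R (d j) l}"
      have "\<exists>z\<in>X. lt R (d j) z \<and> (\<forall>l\<in>?L. lt R z l)"
        using fin XA by (intro dense_set_below_finite[OF dense jX]) auto
      then obtain z where z: "z \<in> X" "lt R (d j) z" "\<forall>l\<in>?L. lt R z l" by blast
      have "lt R z (d k)" if k: "k \<in> I" "lt R (d j) (d k)" for k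
      proof (cases "d k \<in> X")
        case False
        then show ?thesis using conv[OF jX z(1) k(2)] lt_total[of "d k" z] cdA(2)[OF k(1)] z(1) XA by blast
      qed (use z(3) k in blast)
      then have "if k \<in> insert j C then lt R (d k) z else lt R z (d k)" if "k \<in> I" for k
        using Cd[OF that] that z(2) lt_trans[OF _ z(2), of "d k"] by (cases "k = j"; cases "k \<in> C") auto
      then have "z \<in> gap A R I d (insert j C)" using z(1) XA by (intro gapI) auto
      then show False using e by blast
    qed
  qed
  \<comment> \<open>An entry lies in a gap of the other entries and therefore differs from each of
    them.\<close>
  have injc: "inj_on c I"
  proof (rule inj_onI, rule ccontr)
    fix j k assume h: "j \<in> I" "k \<in> I" "c j = c k" "j \<noteq> k"
    obtain C where "c j \<in> gap A R (I - {j}) c C" using minimal_tame_gap[OF t min h(1)] by blast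
    then show False using gap_avoids[of "c j" "I - {j}" c C k] h by auto
  qed
  have injd: "inj_on d I"
  proof (rule inj_onI, rule ccontr)
    fix j k assume h: "j \<in> I" "k \<in> I" "d j = d k" "j \<noteq> k"
    then have "c j \<noteq> c k" using injc by (auto simp: inj_on_def)
    then show False using lt_total[of "c j" "c k"] cdA(1) lt_cd[of j k] lt_cd[of k j] h lt_irrefl by metis
  qed
  have T: "d ` I = c ` I"
  proof (rule card_subset_eq)
    show "card (d ` I) = card (c ` I)" using injc injd by (simp add: card_image)
  qed (use fin dc in auto)
  \<comment> \<open>\<open>c i\<close> and \<open>d i\<close> have the same rank in the common set
    of entries, and the rank determines the point.\<close>
  have "lower R (c ` I) (c i) = c ` {k \<in> I. lt R (c k) (c i)}" by (auto simp: lower_def)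
  then have "card (lower R (c ` I) (c i)) = card {k \<in> I. lt R (c k) (c i)}"
    using injc by (simp add: card_image inj_on_def)
  moreover have "lower R (d ` I) (d i) = d ` {k \<in> I. lt R (d k) (d i)}" by (auto simp: lower_def)
  then have "card (lower R (d ` I) (d i)) = card {k \<in> I. lt R (d k) (d i)}"
    using injd by (simp add: card_image inj_on_def)
  moreover have "{k \<in> I. lt R (c k) (c i)} = {k \<in> I. lt R (d k) (d i)}" using lt_cd i by auto
  ultimately have "card (lower R (c ` I) (d i)) = card (lower R (c ` I) (c i))" using T by simp
  then show ?thesis
    using inj_on_card_lower[of "c ` I"] fin cA dc[OF i] i unfolding inj_on_def by blast
qed

end

section \<open>Linear orders with a \<open>\<Sigma>\<^sub>3\<close> Scott sentence\<close>

text \<open>The points of all finite gaps are added. An added point lies outside each infinite gap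
  and entirely on one side of it, so the infinite gaps survive whole. Points are natural numbers and
  index themselves, whence the family \<open>id\<close>.\<close>

lemma ex_infinite_gaps:
  fixes A :: "nat set"
  assumes "linord A R" "finite F" "F \<subseteq> A"
  shows "\<exists>G. finite G \<and> F \<subseteq> G \<and> G \<subseteq> A \<and> (\<forall>C. gap A R G id C = {} \<or> infinite (gap A R G id C))"
proof -
  interpret linord A R by fact
  let ?g = "gap A R F id"
  \<comment> \<open>A gap depends only on \<open>C\<close> restricted to \<open>F\<close>, so
    \<open>Pow F\<close> lists all gaps and the union is finite.\<close>
  define U where "U = (\<Union>C\<in>{C \<in> Pow F. finite (?g C)}. ?g C)"
  define G where "G = F \<union> U"
  have "finite U" using assms(2) unfolding U_def by auto
  have "U \<subseteq> A" using gap_subset[of A R F id] unfolding U_def by blast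
  have FG: "F \<subseteq> G" unfolding G_def by simp
  have "infinite (gap A R G id D)" if "x \<in> gap A R G id D" for x D
  proof -
    have sub: "gap A R G id D \<subseteq> ?g D" using FG unfolding gap_def by blast
    have inf: "infinite (?g D)"
    proof
      assume fin: "finite (?g D)"
      have "?g (D \<inter> F) = ?g D" by (rule gap_cong) auto
      then have "D \<inter> F \<in> {C \<in> Pow F. finite (?g C)}" using fin by simp
      then have "?g (D \<inter> F) \<subseteq> U" unfolding U_def by (rule UN_upper)
      moreover have "x \<in> ?g (D \<inter> F)" using that sub \<open>?g (D \<inter> F) = ?g D\<close> by auto
      ultimately have "x \<in> G" unfolding G_def by auto
      then show False using gap_avoids[OF that, of x] by simp
    qed
    have "z \<in> gap A R G id D" if z: "z \<in> ?g D" for z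
    proof -
      have "if f \<in> D then lt R (id f) z else lt R z (id f)" if f: "f \<in> G" for f
      proof (cases "f \<in> F")
        case True
        then show ?thesis using z by (auto simp: gap_def)
      next
        case False
        then obtain C where C: "f \<in> ?g C" "finite (?g C)" using f unfolding G_def U_def by auto
        then have "?g C \<noteq> ?g D" using inf by auto
        then have "C \<inter> F \<noteq> D \<inter> F" using gap_cong[of C F D A R id] by blast
        then obtain i where i: "i \<in> F" "(i \<in> C) \<noteq> (i \<in> D)" by blast
        have xf: "if f \<in> D then lt R f x else lt R x f"
          using \<open>x \<in> gap A R G id D\<close> f by (auto simp: gap_def split: if_splits)
        have xg: "x \<in> ?g D" using sub \<open>x \<in> gap A R G id D\<close> by blast
        show ?thesis
        proof (cases "i \<in> C")
          case True
          then have "lower R (?g D) f = ?g D" using gap_halves[OF C(1) i] by simp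
          then have "lt R x f" "lt R z f" using xg z unfolding lower_def by blast+
          then show ?thesis using xf lt_asym[of x f] by (simp split: if_splits)
        next
          case False
          then have "upper R (?g D) f = ?g D" using gap_halves[OF C(1) i] by simp
          then have "lt R f x" "lt R f z" using xg z unfolding upper_def by blast+
          then show ?thesis using xf lt_asym[of x f] by (simp split: if_splits)
        qed
      qed
      then show ?thesis using z unfolding gap_def by blast
    qed
    then have "?g D \<subseteq> gap A R G id D" by blast
    then show ?thesis using inf finite_subset[of "?g D" "gap A R G id D"] by blast
  qed
  then have "\<forall>C. gap A R G id C = {} \<or> infinite (gap A R G id C)" by blast
  then show ?thesis using assms(2,3) \<open>finite U\<close> \<open>U \<subseteq> A\<close> unfolding G_def by blast
qed

text \<open>Every point outside \<open>F\<close> is replaced by a copy of the rationals.\<close>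

lemma ex_dense_gaps:
  fixes A :: "nat set"
  assumes "linord A R" "A \<noteq> {}" "finite F" "F \<subseteq> A"
    and inf: "\<And>C. gap A R F id C = {} \<or> infinite (gap A R F id C)"
  shows "\<exists>(B :: nat set) S b. countable_structure B S \<and> linord B S \<and>
    (\<forall>n. matched (large R n) A R B S F id b)"
proof -
  interpret A: linord A R by fact
  define e :: "nat \<times> rat \<Rightarrow> nat" where "e = to_nat"
  have e_eq: "e p = e q \<longleftrightarrow> p = q" for p q unfolding e_def by simp
  \<comment> \<open>Over a point of \<open>F\<close> only the rational 0 is kept, so that
    \<open>b\<close> marks the unreplaced points; the order \<open>S0\<close> is
    lexicographic.\<close>
  define B0 where "B0 = {p :: nat \<times> rat. fst p \<in> A \<and> (fst p \<in> F \<longrightarrow> snd p = 0)}"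
  define S0 where "S0 = {(p, q). p \<in> B0 \<and> q \<in> B0 \<and>
    (lt R (fst p) (fst q) \<or> fst p = fst q \<and> snd p \<le> snd q)}"
  define B where "B = e ` B0"
  define S where "S = {(e p, e q) | p q. (p, q) \<in> S0}"
  define b where "b f = e (f, 0)" for f
  have S_e: "(e p, e q) \<in> S \<longleftrightarrow> (p, q) \<in> S0" for p q
  proof
    assume "(e p, e q) \<in> S"
    then obtain p' q' where "e p = e p'" "e q = e q'" "(p', q') \<in> S0" unfolding S_def by blast
    then show "(p, q) \<in> S0" by (simp add: e_eq)
  qed (unfold S_def, blast)
  have S_B: "\<exists>p\<in>B0. \<exists>q\<in>B0. x = e p \<and> y = e q" if "(x, y) \<in> S" for x y
    using that unfolding S_def S0_def by blast
  have lt_e: "lt S (e p) (e q) \<longleftrightarrow> lt R (fst p) (fst q) \<or> fst p = fst q \<and> snd p < snd q"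
    if "p \<in> B0" "q \<in> B0" for p q
  proof -
    have "lt S (e p) (e q) \<longleftrightarrow> (p, q) \<in> S0 \<and> p \<noteq> q" by (simp add: lt_def S_e e_eq)
    then show ?thesis using that A.lt_irrefl[of "fst p"] by (auto simp: S0_def prod_eq_iff)
  qed
  have BA: "fst p \<in> A" if "p \<in> B0" for p using that by (simp add: B0_def)
  have SB: "S \<subseteq> B \<times> B" using S_B unfolding B_def by (auto simp del: split_paired_Ex)
  have "linear_order_on B S"
  proof -
    have "refl_on B S" unfolding refl_on_def B_def by (auto simp: S_e S0_def)
    moreover have "trans S"
    proof (rule transI)
      fix x y z assume xyz: "(x, y) \<in> S" "(y, z) \<in> S"
      obtain p q where pq: "x = e p" "y = e q" using S_B[OF xyz(1)] by blast
      moreover obtain r where r: "z = e r" using S_B[OF xyz(2)] by blast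
      ultimately have "(p, q) \<in> S0" "(q, r) \<in> S0" using xyz S_e by auto
      then have "(p, r) \<in> S0"
        using A.lt_trans[of "fst p" "fst q" "fst r"] unfolding S0_def by auto
      then show "(x, z) \<in> S" by (simp add: pq r S_e)
    qed
    moreover have "antisym S"
    proof (rule antisymI)
      fix x y assume xy: "(x, y) \<in> S" "(y, x) \<in> S"
      obtain p q where pq: "x = e p" "y = e q" using S_B[OF xy(1)] by blast
      then have "(p, q) \<in> S0" "(q, p) \<in> S0" using xy S_e by auto
      then have o: "lt R (fst p) (fst q) \<or> fst p = fst q \<and> snd p \<le> snd q"
        "lt R (fst q) (fst p) \<or> fst q = fst p \<and> snd q \<le> snd p" by (simp_all add: S0_def)
      then have "\<not> lt R (fst p) (fst q)" using A.lt_asym A.lt_irrefl by metis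
      then have "p = q" using o A.lt_irrefl by (simp add: prod_eq_iff)
      then show "x = y" by (simp add: pq)
    qed
    moreover have "total_on B S"
    proof (unfold total_on_def, intro ballI impI)
      fix x y assume "x \<in> B" "y \<in> B"
      then obtain p q where pq: "x = e p" "y = e q" "p \<in> B0" "q \<in> B0" unfolding B_def by blast
      then have "(p, q) \<in> S0 \<or> (q, p) \<in> S0"
        using A.lt_total[of "fst p" "fst q"] BA[OF pq(3)] BA[OF pq(4)] linear[of "snd p" "snd q"] pq(3,4)
        unfolding S0_def by (cases "fst p = fst q") auto
      then show "(x, y) \<in> S \<or> (y, x) \<in> S" by (simp add: pq S_e)
    qed
    ultimately show ?thesis using SB by (simp add: order_on_defs)
  qed
  then have linB: "linord B S" by unfold_locales
  obtain a where "a \<in> A" using assms(2) by blast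
  then have "(a, 0) \<in> B0" by (simp add: B0_def)
  then have cs: "countable_structure B S" using SB unfolding countable_structure_def B_def by auto
  have bF: "(f, 0) \<in> B0" if "f \<in> F" for f using that assms(4) by (auto simp: B0_def)
  have lt_b: "lt S (b f) (e p) \<longleftrightarrow> lt R f (fst p)" "lt S (e p) (b f) \<longleftrightarrow> lt R (fst p) f"
    if "f \<in> F" "p \<in> B0" for f p
    using lt_e[OF bF[OF that(1)] that(2)] lt_e[OF that(2) bF[OF that(1)]] that(1,2)
    unfolding b_def B0_def by auto
  have gap_e: "e p \<in> gap B S F b C \<longleftrightarrow> fst p \<in> gap A R F id C" if "p \<in> B0" for p C
    unfolding gap_def using that BA[OF that] lt_b[OF _ that] by (auto simp: B_def)
  have B0I: "(x, r) \<in> B0" if "x \<in> gap A R F id C" for x r C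
    using that A.gap_avoids[OF that, of x] gap_subset[of A R F id C] by (auto simp: B0_def)
  \<comment> \<open>A nonempty order times the rationals, ordered lexicographically, is dense
    without endpoints: shift by 1 within a fibre or take a midpoint there. The gap of
    \<open>A\<close> being infinite enters separately, through \<open>large\<close>.\<close>
  have dense: "dense_set S (gap B S F b C)" if ne: "gap A R F id C \<noteq> {}" for C
    unfolding dense_set_def
  proof (intro allI impI)
    fix p q x y
    assume h: "p \<longrightarrow> x \<in> gap B S F b C" "q \<longrightarrow> y \<in> gap B S F b C" "p \<and> q \<longrightarrow> lt S x y"
    have ex: "\<exists>s r. w = e (s, r) \<and> (s, r) \<in> B0 \<and> s \<in> gap A R F id C" if wgap: "w \<in> gap B S F b C" for w
    proof -
      obtain k where "w = e k" "k \<in> B0" using wgap gap_subset[of B S F b C] unfolding B_def by blast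
      then show ?thesis using wgap gap_e[of k C] by (cases k) auto
    qed
    have wit: "\<exists>z\<in>gap B S F b C. (p \<longrightarrow> lt S x z) \<and> (q \<longrightarrow> lt S z y)"
      if "s \<in> gap A R F id C" "p \<longrightarrow> lt S x (e (s, r))" "q \<longrightarrow> lt S (e (s, r)) y" for s r
      using that gap_e[OF B0I[OF that(1)], of r C] by (intro bexI[of _ "e (s, r)"]) auto
    have above: "lt S (e (s, r)) (e (s, r + 1))" "lt S (e (s, r - 1)) (e (s, r))"
      if "s \<in> gap A R F id C" for s r
      using lt_e[OF B0I[OF that] B0I[OF that]] by auto
    show "\<exists>z\<in>gap B S F b C. (p \<longrightarrow> lt S x z) \<and> (q \<longrightarrow> lt S z y)"
    proof (cases p)
      case p: True
      then obtain s r where x: "x = e (s, r)" "(s, r) \<in> B0" "s \<in> gap A R F id C" using ex h(1) by blast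
      show ?thesis
      proof (cases q)
        case q: True
        then obtain s' r' where y: "y = e (s', r')" "(s', r') \<in> B0" "s' \<in> gap A R F id C"
          using ex h(2) by blast
        have "lt R s s' \<or> s = s' \<and> r < r'" using h(3) p q lt_e[OF x(2) y(2)] x(1) y(1) by simp
        then show ?thesis
        proof
          assume "lt R s s'"
          then have "lt S (e (s, r + 1)) y" using lt_e[OF B0I[OF x(3)] y(2)] y(1) by simp
          then show ?thesis using wit[OF x(3), of "r + 1"] above(1)[OF x(3), of r] x(1) by blast
        next
          assume s: "s = s' \<and> r < r'"
          then have "lt S x (e (s, (r + r') / 2))" "lt S (e (s, (r + r') / 2)) y"
            using lt_e[OF x(2) B0I[OF x(3)]] lt_e[OF B0I[OF x(3)] y(2)] x(1) y(1) by auto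
          then show ?thesis using wit[OF x(3)] by blast
        qed
      next
        case False
        then show ?thesis using wit[OF x(3), of "r + 1"] above(1)[OF x(3), of r] x(1) by blast
      qed
    next
      case p: False
      show ?thesis
      proof (cases q)
        case True
        then obtain s' r' where y: "y = e (s', r')" "(s', r') \<in> B0" "s' \<in> gap A R F id C"
          using ex h(2) by blast
        then show ?thesis using wit[OF y(3), of "r' - 1"] above(2)[OF y(3), of r'] p by blast
      next
        case False
        then show ?thesis using wit p ne by blast
      qed
    qed
  qed
  have "matched (large R n) A R B S F id b" for n
    unfolding matched_def
  proof (intro conjI ballI allI)
    show "finite F" by fact
    show "id ` F \<subseteq> A" using assms(4) by simp
    show "b ` F \<subseteq> B" using bF unfolding b_def B_def by auto
    show "(id f, id g) \<in> R \<longleftrightarrow> (b f, b g) \<in> S" if "f \<in> F" "g \<in> F" for f g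
      using that bF[OF that(1)] bF[OF that(2)] A.R_refl assms(4) unfolding b_def S_e
      by (auto simp: S0_def lt_def)
    show "gap A R F id C = {} \<and> gap B S F b C = {} \<or>
      large R n (gap A R F id C) \<and> dense_set S (gap B S F b C)" for C
    proof (cases "gap A R F id C = {}")
      case True
      have "gap B S F b C = {}"
      proof (rule ccontr)
        assume "gap B S F b C \<noteq> {}"
        then obtain k where "e k \<in> gap B S F b C" "k \<in> B0"
          using gap_subset[of B S F b C] unfolding B_def by blast
        then show False using gap_e True by blast
      qed
      then show ?thesis using True by blast
    next
      case False
      then have "infinite (gap A R F id C)" using inf by blast
      then show ?thesis using A.large_infinite[OF _ gap_subset] dense[OF False] by blast
    qed
  qed
  then show ?thesis using cs linB by blast
qed

lemma Sigma_3_scott_sentence_imp_Pi_3: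
  fixes A :: "nat set"
  assumes cs: "countable_structure A R" and lin: "linear_order_on A R"
    and Sig: "Sigma_in (natLeq_on 3) \<Phi>" and scott: "scott_sentence A R \<Phi>"
  shows "\<exists>\<Theta>. Pi_in (natLeq_on 3) \<Theta> \<and> scott_sentence A R \<Theta>"
proof -
  have linA: "linord A R" using lin by unfold_locales
  have fvPhi: "fv \<Phi> = {}" and scottD: "\<And>(B :: nat set) S. countable_structure B S \<Longrightarrow>
      models B S \<Phi> \<longleftrightarrow> isomorphic A R B S"
    using scott unfolding scott_sentence_def by auto
  obtain \<phi>s xss where Phi: "\<Phi> = Disj (\<lambda>i. exs (xss i) (\<phi>s i))"
    and lvl: "\<And>i. \<exists>\<beta>. \<beta> <o natLeq_on 3 \<and> Pi_in \<beta> (\<phi>s i)"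
    using Sig
  proof cases
    case Sigma_0
    have "(0, 0) \<in> natLeq_on 3" by simp
    then show ?thesis using Sigma_0 by simp
  next
    case (Sigma_step \<phi> xs)
    then show ?thesis using that by blast
  qed
  obtain a where a: "a \<in> A" using cs unfolding countable_structure_def by blast
  have "sat A R \<Phi> (\<lambda>_. a)"
    using scottD[OF cs] isomorphic_refl a unfolding models_def by auto
  then obtain i v where v: "\<forall>m\<in>set (xss i). v m \<in> A" "\<forall>m. m \<notin> set (xss i) \<longrightarrow> v m = a"
    and satv: "sat A R (\<phi>s i) v"
    unfolding Phi sat.simps sat_exs by blast
  define \<phi> xs where "\<phi> = \<phi>s i" "xs = xss i"
  note defs = this
  obtain \<beta> where \<beta>: "\<beta> <o natLeq_on 3" "Pi_in \<beta> \<phi>" using lvl unfolding defs by blast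
  have "finite (Field (natLeq_on 3))" "card (Field (natLeq_on 3)) = 3" by (simp_all add: Field_natLeq_on)
  then have fin\<beta>: "finite (Field \<beta>)" "card (Field \<beta>) \<le> Suc (Suc 0)"
    using ordLess_finite_card_less[OF \<beta>(1)] by auto
  \<comment> \<open>Any parameters satisfying \<open>\<phi>\<close> pin down the whole structure.
    This is applied twice: to the dense replacement of \<open>A\<close> and to an arbitrary
    countable model of \<open>\<Theta>\<close>.\<close>
  have iso: "isomorphic A R B S" if "countable_structure B S" "range w \<subseteq> B" "sat B S \<phi> w"
    for B :: "nat set" and S w
  proof -
    have "sat B S (exs xs \<phi>) w" unfolding sat_exs using that(2,3) by (intro exI[of _ w]) auto
    then have "sat B S \<Phi> w" unfolding Phi defs by auto
    then show ?thesis using models_sentence_iff[OF fvPhi that(2)] scottD[OF that(1)] by blast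
  qed
  have vA: "range v \<subseteq> A" using v a by (auto simp: image_subset_iff)
  \<comment> \<open>Off the quantified variables \<open>v\<close> has the default value
    \<open>a\<close>, which makes its range finite and allows one finite family to cover it.\<close>
  have "range v \<subseteq> insert a (v ` set (xss i))" using v(2) by auto
  then have "finite (range v)" by (rule finite_subset) simp
  then obtain F where F: "finite F" "range v \<subseteq> F" "F \<subseteq> A"
    "\<forall>C. gap A R F id C = {} \<or> infinite (gap A R F id C)"
    using ex_infinite_gaps[OF linA _ vA] by blast
  obtain B :: "nat set" and S b where csB: "countable_structure B S" and linB: "linord B S"
    and mB: "\<And>n. matched (large R n) A R B S F id b"
    using ex_dense_gaps[OF linA _ F(1,3)] F(4) a by blast
  define w where "w m = b (v m)" for m
  have "covers F id b v w" using F(2) unfolding covers_def w_def by auto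
  then have "bf (Suc (Suc 0)) A R v B S w" by (rule matched_bf_2[OF linA linB mB])
  then have satw: "sat B S \<phi> w" using bf_transfer[OF _ fin\<beta>] \<beta>(2) satv unfolding defs by blast
  have wB: "range w \<subseteq> B" using mB[of 0] F(2) unfolding matched_def w_def by auto
  have AB: "isomorphic A R B S" by (rule iso[OF csB wB satw])
  interpret B: linord B S by fact
  have "B.tame F b"
    using mB[of 0] unfolding matched_def B.tame_def by blast
  then obtain Ic where "B.tame (fst Ic) (snd Ic)"
    "\<forall>Jd. B.tame (fst Jd) (snd Jd) \<longrightarrow> card (fst Ic) \<le> card (fst Jd)"
    using ex_has_least_nat[of "\<lambda>Ic. B.tame (fst Ic) (snd Ic)" "(F, b)" "\<lambda>Ic. card (fst Ic)"] by auto
  then obtain I c where tame: "B.tame I c" and min: "\<forall>J d. B.tame J d \<longrightarrow> card I \<le> card J"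
    by (metis fst_conv snd_conv)
  have fI: "finite I" and cI: "c ` I \<subseteq> B" using tame by (auto simp: B.tame_def)
  \<comment> \<open>Subsets of \<open>I\<close> describe all gaps, so \<open>E\<close> and its
    complement in \<open>Pow I\<close> are finite lists of the empty and the dense ones.\<close>
  define E where "E = {C \<in> Pow I. gap B S I c C = {}}"
  define P where "P = {(i, j). (c i, c j) \<in> S}"
  have "finite E" "finite (Pow I - E)" using fI by (auto simp: E_def)
  then obtain \<Theta> where Th: "Pi_in (natLeq_on 3) \<Theta>" "fv \<Theta> = {}"
    "\<And>(C :: nat set) T. countable_structure C T \<Longrightarrow> models C T \<Theta> \<longleftrightarrow>
      linear_order_on C T \<and> (\<exists>d. frame I P E C T d) \<and>
      (\<forall>D\<in>Pow I - E. \<forall>d. frame I P E C T d \<longrightarrow> dense_set T (gap C T I d D))"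
    using ex_frame_sentence[OF fI, of E "Pow I - E" P] by blast
  have emptyE: "gap B S I d D = {}" if "frame I P E B S d" "gap B S I c D = {}" for d D
  proof -
    have "gap B S I c (D \<inter> I) = gap B S I c D" "gap B S I d (D \<inter> I) = gap B S I d D"
      by (rule gap_cong; auto)+
    then show ?thesis using that unfolding frame_def E_def by auto
  qed
  have "models B S \<Theta>"
    unfolding Th(3)[OF csB]
  proof (intro conjI ballI allI impI)
    show "linear_order_on B S" by (rule B.lin)
    show "\<exists>d. frame I P E B S d"
      by (rule exI[of _ c]) (auto simp: frame_def E_def P_def cI)
    fix D d assume D: "D \<in> Pow I - E" and d: "frame I P E B S d"
    \<comment> \<open>By minimality every frame in \<open>B\<close> is \<open>c\<close> itself, and
      the gaps of \<open>c\<close> are known to be dense or empty.\<close>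
    have "d i = c i" if "i \<in> I" for i
      using d by (intro B.minimal_tame_unique[OF tame min _ _ emptyE[OF d] that])
        (auto simp: frame_def P_def)
    then have "gap B S I d D = gap B S I c D" by (rule gap_cong_family)
    moreover have "gap B S I c D \<noteq> {}" using D by (simp add: E_def)
    ultimately show "dense_set S (gap B S I d D)" using tame unfolding B.tame_def by metis
  qed
  moreover have "isomorphic B S C T" if csC: "countable_structure C T" and md: "models C T \<Theta>"
    for C :: "nat set" and T
  proof -
    obtain d where linC: "linear_order_on C T" and d: "frame I P E C T d"
      and dense: "\<And>D. D \<in> Pow I - E \<Longrightarrow> dense_set T (gap C T I d D)"
      using md unfolding Th(3)[OF csC] by blast
    have linC': "linord C T" using linC by unfold_locales
    have "gap B S I c D = {} \<and> gap C T I d D = {} \<or>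
        dense_set S (gap B S I c D) \<and> dense_set T (gap C T I d D)" for D
    proof -
      have eq: "gap B S I c (D \<inter> I) = gap B S I c D" "gap C T I d (D \<inter> I) = gap C T I d D"
        by (rule gap_cong; auto)+
      show ?thesis
      proof (cases "D \<inter> I \<in> E")
        case True
        then show ?thesis using d eq unfolding frame_def E_def by auto
      next
        case False
        then have "gap B S I c D \<noteq> {}" unfolding E_def using eq by auto
        then have "dense_set S (gap B S I c D)" using tame unfolding B.tame_def by blast
        moreover have "dense_set T (gap C T I d D)" using dense[of "D \<inter> I"] False eq by auto
        ultimately show ?thesis by blast
      qed
    qed
    \<comment> \<open>Now both orders have dense gaps. Density is hereditary, so points of
      \<open>B\<close> can be added at will, and it implies \<open>large\<close> at every level, so
      the transfer remains available afterwards.\<close>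
    then have m: "matched (dense_set S) B S C T I c d"
      using fI cI d unfolding matched_def frame_def P_def by simp
    have her: "\<forall>X x. dense_set S X \<longrightarrow> x \<in> X \<longrightarrow> dense_set S (lower S X x) \<and> dense_set S (upper S X x)"
      using B.dense_set_lower B.dense_set_upper by blast
    \<comment> \<open>A variable outside the block shows that the default value \<open>b a\<close>
      of \<open>w\<close> lies in \<open>B\<close>.\<close>
    obtain m0 where "m0 \<notin> set (xss i)" using ex_new_if_finite[OF infinite_UNIV_nat finite_set] by blast
    then have "w m0 = b a" using v(2) by (simp add: w_def)
    then have baB: "b a \<in> B" using wB by (metis range_subsetD)
    obtain I1 c1 d1 k where m1: "matched (dense_set S) B S C T I1 c1 d1" "k \<in> I1" "c1 k = b a"
      by (rule matched_forth_point[OF linB linC' m baB her]) (rule that)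
    \<comment> \<open>All variables have to be covered at once: the constant assignment
      \<open>b a\<close> is covered by a single entry, and \<open>w\<close> differs from it on
      finitely many variables.\<close>
    have cov: "covers I1 c1 d1 (\<lambda>_. b a) (\<lambda>_. d1 k)" 
      unfolding covers_def using m1(2,3) by (intro allI bexI[of _ k]) auto
    have "\<forall>m\<in>set xs. w m \<in> B" using wB by blast
    moreover have "\<forall>m. m \<notin> set xs \<longrightarrow> w m = b a" using v(2) unfolding w_def defs by simp
    ultimately obtain I2 c2 d2 w2 where m2: "matched (dense_set S) B S C T I2 c2 d2" "covers I2 c2 d2 w w2"
      using matched_forth[OF linB linC' m1(1) cov her finite_set, of xs w] by blast
    have "matched (large S n) B S C T I2 c2 d2" for n
      using m2(1) B.dense_set_large by (rule matched_mono)
    then have "bf (Suc (Suc 0)) B S w C T w2" by (rule matched_bf_2[OF linB linC' _ m2(2)])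
    then have sat2: "sat C T \<phi> w2" using bf_transfer[OF _ fin\<beta>] \<beta>(2) satw by blast
    have "range w2 \<subseteq> C"
    proof
      fix y assume "y \<in> range w2"
      then obtain k' where "k' \<in> I2" "y = d2 k'" using m2(2) unfolding covers_def by blast
      then show "y \<in> C" using m2(1) unfolding matched_def by blast
    qed
    then have "isomorphic A R C T" using iso[OF csC _ sat2] by blast
    then show ?thesis using isomorphic_trans[OF isomorphic_sym[OF AB]] by blast
  qed
  ultimately have "scott_sentence B S \<Theta>"
    unfolding scott_sentence_def using Th(2) models_isomorphic by blast
  then have "scott_sentence A R \<Theta>" using scott_sentence_isomorphic[OF AB] by blast
  then show ?thesis using Th(1) by blast
qed

theorem mainTheorem2:
  fixes A :: "'a set" and R :: "'a rel"
  assumes "countable_linear_ordering A R"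
  shows "\<not> has_SSC A R (SigmaIn (natLeq_on 3)) \<and>
    \<not> (has_scott_sentence_in A R (SigmaIn (natLeq_on 3)) \<and>
       \<not> (\<exists>\<Gamma>. complexity_class \<Gamma> \<and> cclass_le \<Gamma> (PiIn (natLeq_on 3)) \<and>
              has_scott_sentence_in A R \<Gamma>))"
proof -
  let ?\<Pi> = "PiIn (natLeq_on 3)"
  have csA: "countable_structure A R" and linA: "linear_order_on A R"
    using assms unfolding countable_linear_ordering_def by auto
  have Pi: "has_scott_sentence_in A R ?\<Pi>" if has: "has_scott_sentence_in A R (SigmaIn (natLeq_on 3))"
  proof -
    obtain \<Phi> where Phi: "Sigma_in (natLeq_on 3) \<Phi>" "scott_sentence A R \<Phi>"
      using has unfolding has_scott_sentence_in_def by auto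
    obtain B :: "nat set" and S where B: "countable_structure B S" "isomorphic A R B S"
      using obtain_nat_copy[OF csA] by blast
    have "linear_order_on B S"
      using linear_order_on_isomorphic[OF B(2) linA] B(1) unfolding countable_structure_def by blast
    then obtain \<Theta> where Th: "Pi_in (natLeq_on 3) \<Theta>" "scott_sentence B S \<Theta>"
      using Sigma_3_scott_sentence_imp_Pi_3[OF B(1) _ Phi(1)] scott_sentence_isomorphic[OF B(2)] Phi(2)
      by blast
    then have "scott_sentence A R \<Theta>" "finite (fv \<Theta>)"
      using scott_sentence_isomorphic[OF B(2)] unfolding scott_sentence_def[of B] by auto
    then show ?thesis using Th(1) unfolding has_scott_sentence_in_def by auto
  qed
  have cc: "complexity_class ?\<Pi>"
    unfolding complexity_class_def cclass_index.simps
    using natLeq_on_Well_order natLeq_on_ordLess[of 1 3] ordLess_imp_ordLeq by auto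
  have "cclass_le ?\<Pi> ?\<Pi>" unfolding cclass_le_def equivalent_def by blast
  \<comment> \<open>The class \<open>?\<Pi>\<close> serves as the \<open>\<Gamma>\<close> of the
    second part; for the first part, a least class \<open>\<Sigma>\<^sub>3\<close> would be
    contained in it, against strictness.\<close>
  then show ?thesis
    using Pi cc not_Sigma_3_le_Pi_3 unfolding has_SSC_def by blast
qed

end
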